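(* Let $d\ge 2$ be a fixed integer and let $p=p_n\in(0,1)$ satisfy $p_n(1-p_n)\gg \frac{\log^4 n}{n^{d-1}}$. Let $H$ be the random $d$-uniform hypergraph $H(n,p_n)$ on $V=\{1,\dots,n\}$, conditioned to be connected, and for $i\neq j$ in $V$ let $\kappa(i,j)=H_{ij}+H_{ji}$ be the commute time between $i$ and $j$ for simple random walk on $H$. Then asymptotically almost surely in $i$ and $j$ $$n(1+o(1))\le\kappa(i,j)\le 2n(1+o(1)),$$ i.e. for every $\varepsilon>0$ and every choice of distinct vertices $i=i_n$, $j=j_n$ in $\{1,\dots,n\}$, the probability (over the random hypergraph) that $(1-\varepsilon)n\le\kappa(i,j)\le 2(1+\varepsilon)n$ tends to $1$ as $n\to\infty$.
   Context: Notation: $a_n\gg b_n$ means $b_n/a_n\to0$ as $n\to\infty$. The random $d$-uniform hypergraph $H(n,p)$ has vertex set $V=\{1,\dots,n\}$, and each $d$-element subset of $V$ is included in the (hyper)edge set $E$ independently with probability $p$. All probabilities are understood conditionally on the event that $H$ is connected (any two vertices are joined by a chain of successively intersecting hyperedges). Simple random walk on $H$: if the walk is at vertex $v$ at time $t$, it chooses uniformly a hyperedge $e\in E$ with $v\in e$, and then moves at time $t+1$ to a vertex $w\in e\setminus\{v\}$ chosen uniformly (probability $\frac1{d-1}$ each). Equivalently, it is simple random walk on the multigraph in which $v\ne w$ are joined by $k$ edges if exactly $k$ hyperedges contain both. $H_{ij}$ denotes the expected time (in the random walk measure, for a fixed realization of the hypergraph) for the walk started at $i$ to reach $j$. Thus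 $\kappa(i,j)$ is a random variable with respect to the random hypergraph. *)

theory Defs
  imports "HOL-Probability.Probability"
begin

text \<open>A hypergraph on the vertex set \<open>{1..n}\<close> is represented by its set of hyperedges.\<close>

definition all_hyperedges :: "nat \<Rightarrow> nat \<Rightarrow> nat set set" where
  "all_hyperedges d n = {e. e \<subseteq> {1..n} \<and> card e = d}"

definition random_hypergraph :: "nat \<Rightarrow> nat \<Rightarrow> real \<Rightarrow> nat set set pmf" where
  "random_hypergraph d n p =
     map_pmf (\<lambda>included. {e \<in> all_hyperedges d n. included e})
       (Pi_pmf (all_hyperedges d n) False (\<lambda>_. bernoulli_pmf p))"

definition connected_hypergraph :: "nat \<Rightarrow> nat set set \<Rightarrow> bool" where
  "connected_hypergraph n E \<longleftrightarrow>
     (\<forall>u\<in>{1..n}. \<forall>v\<in>{1..n}. u \<noteq> v \<longrightarrow>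
        (\<exists>es. es \<noteq> [] \<and> set es \<subseteq> E \<and> u \<in> hd es \<and> v \<in> last es \<and>
              successively (\<lambda>e e'. e \<inter> e' \<noteq> {}) es))"

text \<open>
  One step of the walk from \<open>v\<close>. The distribution is unspecified if \<open>v\<close> lies in no hyperedge;
  this does not occur in a connected hypergraph with at least two vertices.
\<close>

definition walk_step :: "nat set set \<Rightarrow> nat \<Rightarrow> nat pmf" where
  "walk_step E v =
     bind_pmf (pmf_of_set {e \<in> E. v \<in> e}) (\<lambda>e. pmf_of_set (e - {v}))"

text \<open>
  The walk is realised on the space of i.i.d. sequences of random maps: each map sends every
  vertex \<open>v\<close>, independently, to a sample of \<open>walk_step E v\<close>, and the position at time \<open>t + 1\<close> is
  the image of the position at time \<open>t\<close> under the \<open>t\<close>-th map. The lemma \<open>walk_law\<close> below shows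
  that this is the Markov chain with transition probabilities \<open>walk_step E\<close>.
\<close>

definition walk_space :: "nat \<Rightarrow> nat set set \<Rightarrow> (nat \<Rightarrow> nat) stream measure" where
  "walk_space n E = stream_space (measure_pmf (Pi_pmf {1..n} 0 (walk_step E)))"

primrec walk :: "nat \<Rightarrow> (nat \<Rightarrow> nat) stream \<Rightarrow> nat \<Rightarrow> nat" where
  "walk v \<omega> 0 = v"
| "walk v \<omega> (Suc t) = (\<omega> !! t) (walk v \<omega> t)"

text \<open>The first time at which \<open>X\<close> visits \<open>j\<close>; it is \<open>\<infinity>\<close> if there is no such time.\<close>

definition hitting_time :: "(nat \<Rightarrow> nat) \<Rightarrow> nat \<Rightarrow> ennreal" where
  "hitting_time X j = (INF t\<in>{t. X t = j}. of_nat t)"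

definition expected_hitting_time :: "nat \<Rightarrow> nat set set \<Rightarrow> nat \<Rightarrow> nat \<Rightarrow> ennreal" where
  "expected_hitting_time n E i j = (\<integral>\<^sup>+\<omega>. hitting_time (walk i \<omega>) j \<partial>walk_space n E)"

definition commute_time :: "nat \<Rightarrow> nat set set \<Rightarrow> nat \<Rightarrow> nat \<Rightarrow> ennreal" where
  "commute_time n E i j = expected_hitting_time n E i j + expected_hitting_time n E j i"

lemma walk_Suc_shift: "walk v (f ## \<omega>) (Suc t) = walk (f v) \<omega> t"
  by (induction t) auto

lemma measurable_walk_space_count_space [measurable]:
  "(\<lambda>\<omega>. walk v \<omega> t) \<in> walk_space n E \<rightarrow>\<^sub>M count_space UNIV"
proof (induction t arbitrary: v)
  case 0
  show ?case by simp
next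
  case (Suc t)
  let ?M = "measure_pmf (Pi_pmf {1..n} 0 (walk_step E))"
  have snth: "(\<lambda>\<omega>. \<omega> !! t) \<in> walk_space n E \<rightarrow>\<^sub>M count_space UNIV"
    unfolding walk_space_def
    using measurable_snth[of t ?M] by (simp cong: measurable_cong_sets)
  have "(\<lambda>\<omega>. (\<lambda>k \<omega>. (\<omega> !! t) k) (walk v \<omega> t) \<omega>) \<in> walk_space n E \<rightarrow>\<^sub>M count_space UNIV"
    by (rule measurable_compose_countable[OF _ Suc])
       (rule measurable_compose[OF snth], simp)
  then show ?case by simp
qed

lemma measurable_hitting_time [measurable]:
  "(\<lambda>\<omega>. hitting_time (walk v \<omega>) j) \<in> borel_measurable (walk_space n E)"
proof -
  have eq: "hitting_time (walk v \<omega>) j =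
      (INF t. if walk v \<omega> t = j then of_nat t else \<infinity>)" for \<omega>
    unfolding hitting_time_def
  proof (rule antisym)
    show "(INF t\<in>{t. walk v \<omega> t = j}. of_nat t) \<le>
        (INF t. if walk v \<omega> t = j then of_nat t else (\<infinity> :: ennreal))"
      by (intro INF_greatest) (auto intro: INF_lower)
    show "(INF t. if walk v \<omega> t = j then of_nat t else (\<infinity> :: ennreal)) \<le>
        (INF t\<in>{t. walk v \<omega> t = j}. of_nat t)"
    proof (rule INF_greatest)
      fix t assume "t \<in> {t. walk v \<omega> t = j}"
      then show "(INF t. if walk v \<omega> t = j then of_nat t else (\<infinity> :: ennreal)) \<le> of_nat t"
        by (intro INF_lower2[of t]) auto
    qed
  qed
  show ?thesis unfolding eq by measurable
qed

lemma walk_law: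
  assumes "v \<in> {1..n}" "\<And>s. s \<le> t \<Longrightarrow> x s \<in> {1..n}"
  shows "emeasure (walk_space n E) {\<omega> \<in> space (walk_space n E). \<forall>s\<le>t. walk v \<omega> s = x s} =
         ennreal ((if x 0 = v then 1 else 0) * (\<Prod>s<t. pmf (walk_step E (x s)) (x (Suc s))))"
  using assms
proof (induction t arbitrary: v x)
  case 0
  interpret S: prob_space "walk_space n E"
    unfolding walk_space_def by (intro prob_space.prob_space_stream_space measure_pmf.prob_space_axioms)
  show ?case using S.emeasure_space_1 by auto
next
  case (Suc t)
  let ?M = "measure_pmf (Pi_pmf {1..n} 0 (walk_step E))"
  let ?A = "\<lambda>v x t. {\<omega> \<in> space (walk_space n E). \<forall>s\<le>t. walk v \<omega> s = x s}"
  have A: "?A v x t \<in> sets (walk_space n E)" for v x t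
    by measurable
  let ?c = "\<Prod>s<t. pmf (walk_step E (x (Suc s))) (x (Suc (Suc s)))"
  have split: "(\<forall>s\<le>Suc t. walk v (f ## \<omega>) s = x s) \<longleftrightarrow>
      x 0 = v \<and> (\<forall>s\<le>t. walk (f v) \<omega> s = x (Suc s))" for f \<omega>
    unfolding less_Suc_eq_le[symmetric] All_less_Suc2 by (auto simp: walk_Suc_shift simp del: walk.simps(2))
  have ne: "emeasure (walk_space n E) (?A (f v) (\<lambda>s. x (Suc s)) t) =
      ennreal ?c * indicator {f. f v = x 1} f" for f
  proof (cases "f v = x 1")
    case True
    then show ?thesis using Suc.IH[where v = "f v" and x = "\<lambda>s. x (Suc s)"] Suc.prems(2) by simp
  next
    case False
    then have "?A (f v) (\<lambda>s. x (Suc s)) t = {}" by auto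
    with False show ?thesis by (simp only: emeasure_empty) simp
  qed
  have "emeasure (walk_space n E) (?A v x (Suc t)) =
      (\<integral>\<^sup>+f. emeasure (walk_space n E)
         {\<omega> \<in> space (walk_space n E). f ## \<omega> \<in> ?A v x (Suc t)} \<partial>?M)"
    using A[where v = v and x = x and t = "Suc t"] unfolding walk_space_def
    by (rule prob_space.emeasure_stream_space[OF measure_pmf.prob_space_axioms])
  also have "\<dots> = (\<integral>\<^sup>+f. (if x 0 = v then 1 else 0) * (ennreal ?c * indicator {f. f v = x 1} f) \<partial>?M)"
  proof (rule nn_integral_cong)
    fix f
    have "{\<omega> \<in> space (walk_space n E). f ## \<omega> \<in> ?A v x (Suc t)} =
        (if x 0 = v then ?A (f v) (\<lambda>s. x (Suc s)) t else {})"
      by (auto simp: split walk_space_def space_stream_space simp del: walk.simps)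
    then show "emeasure (walk_space n E) {\<omega> \<in> space (walk_space n E). f ## \<omega> \<in> ?A v x (Suc t)} =
        (if x 0 = v then 1 else 0) * (ennreal ?c * indicator {f. f v = x 1} f)"
      using ne[of f] by simp
  qed
  also have "\<dots> = (if x 0 = v then 1 else 0) * (ennreal ?c * emeasure ?M {f. f v = x 1})"
    by (simp add: nn_integral_cmult)
  also have "emeasure ?M {f. f v = x 1} = ennreal (pmf (walk_step E v) (x 1))"
  proof -
    have "emeasure ?M {f. f v = x 1} =
        emeasure (map_pmf (\<lambda>f. f v) (Pi_pmf {1..n} 0 (walk_step E))) {x 1}"
      by (simp add: vimage_def)
    also have "map_pmf (\<lambda>f. f v) (Pi_pmf {1..n} 0 (walk_step E)) = walk_step E v"
      using Suc.prems(1) by (subst Pi_pmf_component) auto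
    finally show ?thesis by (simp add: emeasure_pmf_single)
  qed
  finally show ?case
    by (auto simp: prod.lessThan_Suc_shift ennreal_mult'[symmetric] prod_nonneg mult.commute
             simp del: prod.lessThan_Suc)
qed

end

theory Submission
  imports Defs
begin

text \<open>
  Write \<open>c u v\<close> for the number of hyperedges that contain the distinct vertices \<open>u\<close> and \<open>v\<close>. The
  walk is the reversible walk on the network with conductances \<open>c\<close>; its reversing measure gives
  a vertex the weight \<open>d - 1\<close> times its degree. Let \<open>W\<close> be the total weight. If \<open>\<phi>\<close> is the mean
  hitting time of \<open>j\<close> minus the mean hitting time of \<open>i\<close>, as functions of the starting vertex, then
  \<open>\<phi>\<close> has Laplacian \<open>W\<close> at \<open>i\<close>, \<open>- W\<close> at \<open>j\<close> and \<open>0\<close> elsewhere, and \<open>\<phi> i - \<phi> j\<close> is the commute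
  time \<open>\<kappa>\<close>. Shifting and rescaling \<open>\<phi>\<close> to a function \<open>g\<close> with \<open>g i = 1\<close> and \<open>g j = 0\<close> gives
  \<open>\<kappa> = W / energy g\<close>. All bounds on \<open>\<kappa>\<close> come from this (lemma \<open>commute_bounds\<close>).

  For the lower bound, Cauchy-Schwarz for the Dirichlet form against the indicator of \<open>i\<close> gives
  \<open>\<kappa> \<ge> W / weight i\<close>, which is about \<open>n\<close> when the degrees are nearly equal.

  For the upper bound one needs an energy of at least about \<open>m / 2\<close>, where \<open>m\<close> is the typical
  weight of a vertex. If the network is an edge expander, Cheeger's argument shows that \<open>g\<close> has
  bounded square distance from a constant \<open>a\<close> as soon as its energy is of order \<open>m\<close>
  (lemma \<open>poincare\<close>). Each edge multiplicity is \<open>o(m)\<close>, so a bounded square distance is invisible to the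
  average over the edges at \<open>i\<close>, whose weights add up to about \<open>m\<close>: most neighbours of \<open>i\<close> have
  values close to \<open>a\<close>, and so have those of \<open>j\<close>. The edges at \<open>i\<close> and \<open>j\<close> therefore already contribute
  about \<open>m * ((1 - a)\<^sup>2 + a\<^sup>2) \<ge> m / 2\<close> (lemma \<open>energy_lower_bound\<close>), and \<open>W\<close> is about
  \<open>n * m\<close>. The constant in the Poincare inequality affects only the error terms, so
  expansion of constant order suffices.

  The random hypergraph has the required properties with probability tending to \<open>1\<close>
  (lemma \<open>pseudorandom_asymptotically_almost_surely\<close>). The mean degree \<open>\<mu>\<close> grows faster than
  \<open>ln n\<close>, so each Chernoff bound beats its union bound: over the vertices for the degrees,
  over the pairs of vertices for the codegrees, and over all vertex sets \<open>S\<close> for the expansion, where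
  the failure probability \<open>q ^ card S\<close> sums to \<open>(1 + q) ^ n - 1\<close>. Expansion implies connectedness, so
  conditioning on connectedness can only increase the probability of the good event.
\<close>

section \<open>Dirichlet forms on finite networks\<close>

locale network =
  fixes V :: "'a set" and c :: "'a \<Rightarrow> 'a \<Rightarrow> real"
  assumes finite_V: "finite V"
    and c_sym: "c u v = c v u"
    and c_nonneg: "0 \<le> c u v"
begin

definition weight :: "'a \<Rightarrow> real" where
  "weight v = (\<Sum>w\<in>V. c v w)"

definition cut :: "'a set \<Rightarrow> real" where
  "cut S = (\<Sum>u\<in>S. \<Sum>v\<in>V - S. c u v)"

definition energy :: "('a \<Rightarrow> real) \<Rightarrow> real" where
  "energy g = (\<Sum>u\<in>V. \<Sum>v\<in>V. c u v * (g u - g v)\<^sup>2) / 2"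

definition laplacian :: "('a \<Rightarrow> real) \<Rightarrow> 'a \<Rightarrow> real" where
  "laplacian g u = (\<Sum>v\<in>V. c u v * (g u - g v))"

lemma sum_sym: "(\<Sum>u\<in>V. \<Sum>v\<in>V. c u v * F u v) = (\<Sum>u\<in>V. \<Sum>v\<in>V. c u v * F v u)"
  by (subst sum.swap) (simp add: c_sym)

lemma green_identity:
  "(\<Sum>u\<in>V. f u * laplacian g u) = (\<Sum>u\<in>V. \<Sum>v\<in>V. c u v * ((f u - f v) * (g u - g v))) / 2"
proof -
  have "(\<Sum>u\<in>V. f u * laplacian g u) = (\<Sum>u\<in>V. \<Sum>v\<in>V. c u v * (f u * (g u - g v)))"
    by (simp add: laplacian_def sum_distrib_left mult_ac)
  moreover from this
  have "(\<Sum>u\<in>V. f u * laplacian g u) = (\<Sum>u\<in>V. \<Sum>v\<in>V. c u v * (f v * (g v - g u)))"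
    by (simp add: sum_sym[of "\<lambda>u v. f u * (g u - g v)"])
  ultimately have "2 * (\<Sum>u\<in>V. f u * laplacian g u) =
      (\<Sum>u\<in>V. \<Sum>v\<in>V. c u v * (f u * (g u - g v)) + c u v * (f v * (g v - g u)))"
    by (simp add: sum.distrib)
  also have "\<dots> = (\<Sum>u\<in>V. \<Sum>v\<in>V. c u v * ((f u - f v) * (g u - g v)))"
    by (intro sum.cong refl) (simp add: algebra_simps)
  finally show ?thesis by simp
qed

lemma energy_eq_laplacian: "energy g = (\<Sum>u\<in>V. g u * laplacian g u)"
  by (simp add: green_identity energy_def power2_eq_square)

lemma energy_nonneg: "0 \<le> energy g"
  unfolding energy_def by (intro divide_nonneg_nonneg sum_nonneg mult_nonneg_nonneg c_nonneg) auto

lemma sum_laplacian: "(\<Sum>u\<in>V. laplacian g u) = 0"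
  using green_identity[of "\<lambda>_. 1" g] by simp

section \<open>A Poincare inequality from edge expansion\<close>

text \<open>
  A nonnegative function is a positive combination of the indicators of its superlevel sets, and both
  sides are additive along that decomposition. The induction removes the lowest layer: it subtracts
  the smallest positive value on the support.
\<close>

lemma coarea:
  fixes b :: real
  assumes iso: "\<And>S. S \<subseteq> V \<Longrightarrow> S \<noteq> {} \<Longrightarrow> 2 * card S \<le> card V \<Longrightarrow> b * card S \<le> cut S"
  assumes "\<And>v. v \<in> V \<Longrightarrow> 0 \<le> F v" "2 * card {v\<in>V. 0 < F v} \<le> card V"
  shows "b * (\<Sum>v\<in>V. F v) \<le> (\<Sum>u\<in>V. \<Sum>v\<in>V. c u v * \<bar>F u - F v\<bar>) / 2"
  using assms(2,3)
proof (induction "card {v\<in>V. 0 < F v}" arbitrary: F rule: less_induct)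
  case less
  define S where "S = {v\<in>V. 0 < F v}"
  have S: "S \<subseteq> V" "finite S" using finite_V by (auto simp: S_def)
  show ?case
  proof (cases "S = {}")
    case True
    then have "\<And>v. v \<in> V \<Longrightarrow> F v = 0" using less.prems(1) by (force simp: S_def)
    then show ?thesis by (simp add: sum_nonneg c_nonneg)
  next
    case False
    define m where "m = Min (F ` S)"
    define G where "G v = (if v \<in> S then F v - m else F v)" for v
    have m: "m \<in> F ` S" "\<And>v. v \<in> S \<Longrightarrow> m \<le> F v"
      using S False by (auto simp: m_def)
    then have "0 < m" by (auto simp: S_def)
    have off: "F v = 0" if "v \<in> V - S" for v using that less.prems(1)[of v] by (auto simp: S_def)
    have G0: "0 \<le> G v" if "v \<in> V" for v using that m(2) off by (auto simp: G_def)
    have sub: "{v\<in>V. 0 < G v} \<subset> S"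
    proof
      show "{v\<in>V. 0 < G v} \<subseteq> S" using \<open>0 < m\<close> off by (auto simp: G_def S_def split: if_splits)
      from m(1) obtain v where "v \<in> S" "F v = m" by auto
      then have "v \<in> S" "G v = 0" by (auto simp: G_def)
      then show "{v\<in>V. 0 < G v} \<noteq> S" by force
    qed
    have "card {v\<in>V. 0 < G v} < card S" using sub S by (meson psubset_card_mono)
    then have IH: "b * (\<Sum>v\<in>V. G v) \<le> (\<Sum>u\<in>V. \<Sum>v\<in>V. c u v * \<bar>G u - G v\<bar>) / 2"
      using less.prems(2) G0 by (intro less.hyps) (auto simp: S_def)
    let ?I = "\<lambda>v. if v \<in> S then 1 else 0 :: real"
    have sumF: "(\<Sum>v\<in>V. F v) = (\<Sum>v\<in>V. G v) + m * card S"
    proof -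
      have "(\<Sum>v\<in>V. F v) = (\<Sum>v\<in>V. G v + m * ?I v)"
        by (intro sum.cong) (auto simp: G_def)
      also have "\<dots> = (\<Sum>v\<in>V. G v) + m * (\<Sum>v\<in>V. ?I v)"
        by (simp add: sum.distrib sum_distrib_left)
      also have "(\<Sum>v\<in>V. ?I v) = card S"
        using S finite_V by (simp add: sum.If_cases Int_absorb1)
      finally show ?thesis .
    qed
    have cutS: "(\<Sum>u\<in>V. \<Sum>v\<in>V. c u v * \<bar>?I u - ?I v\<bar>) = 2 * cut S"
    proof -
      have inS: "(\<Sum>v\<in>V. c u v * \<bar>?I u - ?I v\<bar>) = (\<Sum>v\<in>V - S. c u v)" if "u \<in> S" for u
        using that S finite_V by (intro sum.mono_neutral_cong_right) auto
      have outS: "(\<Sum>v\<in>V. c u v * \<bar>?I u - ?I v\<bar>) = (\<Sum>v\<in>S. c u v)" if "u \<in> V - S" for u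
        using that S finite_V by (intro sum.mono_neutral_cong_right) auto
      have "(\<Sum>u\<in>V. \<Sum>v\<in>V. c u v * \<bar>?I u - ?I v\<bar>) =
          (\<Sum>u\<in>V - S. \<Sum>v\<in>S. c u v) + (\<Sum>u\<in>S. \<Sum>v\<in>V - S. c u v)"
        unfolding sum.subset_diff[OF S(1) finite_V, of "\<lambda>u. \<Sum>v\<in>V. c u v * \<bar>?I u - ?I v\<bar>"]
        by (intro arg_cong2[where f = "(+)"] sum.cong refl inS outS)
      also have "(\<Sum>u\<in>V - S. \<Sum>v\<in>S. c u v) = (\<Sum>u\<in>S. \<Sum>v\<in>V - S. c u v)"
        by (subst sum.swap) (simp add: c_sym)
      finally show ?thesis by (simp add: cut_def)
    qed
    have "\<bar>F u - F v\<bar> = \<bar>G u - G v\<bar> + m * \<bar>?I u - ?I v\<bar>" if "u \<in> V" "v \<in> V" for u v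
      using that m(2)[of u] m(2)[of v] off[of u] off[of v] \<open>0 < m\<close> by (auto simp: G_def)
    then have "(\<Sum>u\<in>V. \<Sum>v\<in>V. c u v * \<bar>F u - F v\<bar>) =
        (\<Sum>u\<in>V. \<Sum>v\<in>V. c u v * \<bar>G u - G v\<bar> + m * (c u v * \<bar>?I u - ?I v\<bar>))"
      by (intro sum.cong refl) (simp add: algebra_simps)
    also have "\<dots> = (\<Sum>u\<in>V. \<Sum>v\<in>V. c u v * \<bar>G u - G v\<bar>) + m * (2 * cut S)"
      unfolding cutS[symmetric] sum.distrib sum_distrib_left by simp
    finally have "(\<Sum>u\<in>V. \<Sum>v\<in>V. c u v * \<bar>F u - F v\<bar>) / 2 =
        (\<Sum>u\<in>V. \<Sum>v\<in>V. c u v * \<bar>G u - G v\<bar>) / 2 + m * cut S" by simp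
    moreover have "m * (b * card S) \<le> m * cut S"
      using iso[of S] S(1) False less.prems(2) \<open>0 < m\<close> by (intro mult_left_mono) (auto simp: S_def)
    ultimately show ?thesis using IH by (simp add: sumF algebra_simps)
  qed
qed

text \<open>
  Cheeger's argument: the coarea inequality for \<open>f\<^sup>2\<close>, followed by
  \<open>\<bar>(f u)\<^sup>2 - (f v)\<^sup>2\<bar> = \<bar>f u - f v\<bar> * \<bar>f u + f v\<bar>\<close>; the first factor produces the energy, and the
  second a multiple of the left-hand side, because the weights are bounded.
\<close>

lemma cheeger_half:
  fixes \<beta> m :: real
  assumes iso: "\<And>S. S \<subseteq> V \<Longrightarrow> S \<noteq> {} \<Longrightarrow> 2 * card S \<le> card V \<Longrightarrow> \<beta> * m * card S \<le> cut S"
    and "0 < \<beta>" "0 < m" and wt: "\<And>v. v \<in> V \<Longrightarrow> weight v \<le> 2 * m"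
    and f: "\<And>v. v \<in> V \<Longrightarrow> 0 \<le> f v" "2 * card {v\<in>V. 0 < f v} \<le> card V"
  shows "(\<Sum>v\<in>V. (f v)\<^sup>2) \<le> 4 / (\<beta>\<^sup>2 * m) * energy f"
proof -
  let ?Q = "\<Sum>v\<in>V. (f v)\<^sup>2"
  have "(0 < (f v)\<^sup>2) = (0 < f v)" if "v \<in> V" for v using f(1)[OF that] by auto
  then have sq: "{v \<in> V. 0 < (f v)\<^sup>2} = {v \<in> V. 0 < f v}" by blast
  have "\<beta> * m * ?Q \<le> (\<Sum>u\<in>V. \<Sum>v\<in>V. c u v * \<bar>(f u)\<^sup>2 - (f v)\<^sup>2\<bar>) / 2"
    by (rule coarea, erule (2) iso) (use f(2) in \<open>simp_all only: sq zero_le_power2\<close>)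
  also have "(\<Sum>u\<in>V. \<Sum>v\<in>V. c u v * \<bar>(f u)\<^sup>2 - (f v)\<^sup>2\<bar>) \<le>
      (\<Sum>u\<in>V. \<Sum>v\<in>V. 2 / \<beta> * (c u v * (f u - f v)\<^sup>2) + \<beta> / 4 * (c u v * (f u)\<^sup>2 + c u v * (f v)\<^sup>2))"
  proof (intro sum_mono)
    fix u v
    \<comment> \<open>weighted AM-GM; the weight is chosen so that the second term below is absorbed on the left\<close>
    have "\<bar>(f u)\<^sup>2 - (f v)\<^sup>2\<bar> = \<bar>f u - f v\<bar> * \<bar>f u + f v\<bar>"
      by (simp add: abs_mult[symmetric] power2_eq_square algebra_simps)
    also have "\<dots> \<le> 2 / \<beta> * \<bar>f u - f v\<bar>\<^sup>2 + \<beta> / 8 * \<bar>f u + f v\<bar>\<^sup>2"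
    proof -
      have "0 \<le> 2 / \<beta> * (\<bar>f u - f v\<bar> - \<beta> / 4 * \<bar>f u + f v\<bar>)\<^sup>2" using \<open>0 < \<beta>\<close> by simp
      also have "\<dots> = 2 / \<beta> * \<bar>f u - f v\<bar>\<^sup>2 + \<beta> / 8 * \<bar>f u + f v\<bar>\<^sup>2 - \<bar>f u - f v\<bar> * \<bar>f u + f v\<bar>"
        using \<open>0 < \<beta>\<close> by (simp add: power2_eq_square field_simps)
      finally show ?thesis by simp
    qed
    also have "\<dots> \<le> 2 / \<beta> * (f u - f v)\<^sup>2 + \<beta> / 4 * ((f u)\<^sup>2 + (f v)\<^sup>2)"
    proof -
      have "(f u + f v)\<^sup>2 \<le> 2 * ((f u)\<^sup>2 + (f v)\<^sup>2)"
        using zero_le_power2[of "f u - f v"] by (simp add: power2_eq_square algebra_simps)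
      from mult_left_mono[OF this, of "\<beta> / 8"] \<open>0 < \<beta>\<close> show ?thesis by simp
    qed
    finally show "c u v * \<bar>(f u)\<^sup>2 - (f v)\<^sup>2\<bar> \<le>
        2 / \<beta> * (c u v * (f u - f v)\<^sup>2) + \<beta> / 4 * (c u v * (f u)\<^sup>2 + c u v * (f v)\<^sup>2)"
      using mult_left_mono[OF _ c_nonneg[of u v]] by (fastforce simp: algebra_simps)
  qed
  also have "\<dots> = 4 / \<beta> * energy f + \<beta> / 4 * (2 * (\<Sum>v\<in>V. weight v * (f v)\<^sup>2))"
  proof -
    have "(\<Sum>u\<in>V. \<Sum>v\<in>V. c u v * (f u)\<^sup>2) = (\<Sum>v\<in>V. weight v * (f v)\<^sup>2)"
      by (simp add: weight_def sum_distrib_right)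
    moreover from this have "(\<Sum>u\<in>V. \<Sum>v\<in>V. c u v * (f v)\<^sup>2) = (\<Sum>v\<in>V. weight v * (f v)\<^sup>2)"
      using sum_sym[of "\<lambda>u v. (f u)\<^sup>2"] by simp
    ultimately show ?thesis
      by (simp only: sum.distrib sum_distrib_left[symmetric] energy_def) (simp add: distrib_left)
  qed
  also have "(\<Sum>v\<in>V. weight v * (f v)\<^sup>2) \<le> 2 * m * ?Q"
    unfolding sum_distrib_left by (intro sum_mono mult_right_mono wt) auto
  finally have "\<beta> * m * ?Q \<le> 2 / \<beta> * energy f + \<beta> / 2 * m * ?Q"
    using \<open>0 < \<beta>\<close> by (simp add: mult_left_mono)
  then have "\<beta> * m / 2 * ?Q \<le> 2 / \<beta> * energy f" by simp
  from mult_left_mono[OF this, of "2 / (\<beta> * m)"] show ?thesis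
    using \<open>0 < \<beta>\<close> \<open>0 < m\<close> by (simp add: power2_eq_square field_simps)
qed

lemma ex_median:
  fixes g :: "'a \<Rightarrow> real"
  obtains a where "2 * card {v\<in>V. a < g v} \<le> card V" "2 * card {v\<in>V. g v < a} \<le> card V"
proof (cases "V = {}")
  case True
  then show ?thesis by (intro that[of 0]) auto
next
  case False
  let ?U = "\<lambda>a. {v\<in>V. a < g v}"
  let ?A = "{a \<in> g ` V. 2 * card (?U a) \<le> card V}"
  have fin: "finite ?A" using finite_V by auto
  have "?U (Max (g ` V)) = {}" using finite_V False by (auto simp: not_less[symmetric] Max_gr_iff)
  moreover have "Max (g ` V) \<in> g ` V" using finite_V False by (intro Max_in) auto
  ultimately have "Max (g ` V) \<in> ?A" by (simp only: mem_Collect_eq) simp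
  then have ne: "?A \<noteq> {}" by blast
  define a where "a = Min ?A"
  have a: "a \<in> ?A" unfolding a_def by (rule Min_in[OF fin ne])
  have "2 * card {v\<in>V. g v < a} \<le> card V"
  proof (cases "{v\<in>V. g v < a} = {}")
    case True
    then show ?thesis by (metis card.empty mult_0_right zero_le)
  next
    case L: False
    \<comment> \<open>\<open>b\<close> is the value of \<open>g\<close> immediately below \<open>a\<close>; it fails the defining condition of \<open>a\<close>\<close>
    define b where "b = Max (g ` {v\<in>V. g v < a})"
    have b: "b \<in> g ` {v\<in>V. g v < a}" unfolding b_def using finite_V L by (intro Max_in) auto
    have "b \<notin> ?A" using Min_le[OF fin, of b] b by (auto simp: a_def[symmetric])
    then have "card V < 2 * card (?U b)" using b by auto
    moreover have "{v\<in>V. g v < a} \<inter> ?U b = {}"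
    proof -
      have "g v \<le> b" if "v \<in> V" "g v < a" for v
        unfolding b_def using finite_V that by (intro Max_ge) auto
      then show ?thesis by force
    qed
    then have "card {v\<in>V. g v < a} + card (?U b) \<le> card V"
      using finite_V by (subst card_Un_disjoint[symmetric]) (auto intro: card_mono)
    ultimately show ?thesis by linarith
  qed
  with a show ?thesis by (intro that[of a]) auto
qed

text \<open>
  Subtracting a median \<open>a\<close> makes the supports of the positive and of the negative part of \<open>g - a\<close> small
  enough for \<open>cheeger_half\<close>, and the energies of the two parts add up to at most that of \<open>g\<close>.
\<close>

lemma poincare:
  fixes \<beta> m :: real
  assumes iso: "\<And>S. S \<subseteq> V \<Longrightarrow> S \<noteq> {} \<Longrightarrow> 2 * card S \<le> card V \<Longrightarrow> \<beta> * m * card S \<le> cut S"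
    and pos: "0 < \<beta>" "0 < m" and wt: "\<And>v. v \<in> V \<Longrightarrow> weight v \<le> 2 * m"
  obtains a where "(\<Sum>v\<in>V. (g v - a)\<^sup>2) \<le> 4 / (\<beta>\<^sup>2 * m) * energy g"
proof -
  obtain a where a: "2 * card {v\<in>V. a < g v} \<le> card V" "2 * card {v\<in>V. g v < a} \<le> card V"
    by (rule ex_median)
  let ?p = "\<lambda>v. max 0 (g v - a)" and ?n = "\<lambda>v. max 0 (a - g v)"
  have "(\<Sum>v\<in>V. (g v - a)\<^sup>2) = (\<Sum>v\<in>V. (?p v)\<^sup>2) + (\<Sum>v\<in>V. (?n v)\<^sup>2)"
    unfolding sum.distrib[symmetric] by (intro sum.cong) (auto simp: max_def power2_eq_square algebra_simps)
  also have "\<dots> \<le> 4 / (\<beta>\<^sup>2 * m) * energy ?p + 4 / (\<beta>\<^sup>2 * m) * energy ?n"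
    using a by (intro add_mono cheeger_half iso pos wt) (auto simp: less_max_iff_disj)
  also have "\<dots> = 4 / (\<beta>\<^sup>2 * m) * (energy ?p + energy ?n)" by (simp add: distrib_left)
  also have "\<dots> \<le> 4 / (\<beta>\<^sup>2 * m) * energy g"
  proof (intro mult_left_mono)
    have le: "(?p u - ?p v)\<^sup>2 + (?n u - ?n v)\<^sup>2 \<le> (g u - g v)\<^sup>2" for u v
    proof -
      have "(?p u - ?p v) * (?n u - ?n v) \<le> 0"
        by (auto simp: max_def mult_nonneg_nonpos mult_nonpos_nonneg mult_le_0_iff)
      moreover have "g u - g v = (?p u - ?p v) - (?n u - ?n v)" by (auto simp: max_def)
      then have "(g u - g v)\<^sup>2 = (?p u - ?p v)\<^sup>2 + (?n u - ?n v)\<^sup>2 - 2 * ((?p u - ?p v) * (?n u - ?n v))"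
        by (simp only: power2_diff mult.assoc)
      ultimately show ?thesis by linarith
    qed
    show "energy ?p + energy ?n \<le> energy g"
      unfolding energy_def add_divide_distrib[symmetric] sum.distrib[symmetric] distrib_left[symmetric]
      by (intro divide_right_mono sum_mono mult_left_mono le c_nonneg) auto
  qed (use pos in auto)
  finally show ?thesis by (rule that)
qed

section \<open>Commute times and the Dirichlet energy\<close>

text \<open>
  The subtracted term corrects for the edge between \<open>i\<close> and \<open>j\<close>, which lies in both stars.
\<close>

lemma energy_ge_two_stars:
  assumes ij: "i \<in> V" "j \<in> V" "i \<noteq> j"
  shows "(\<Sum>w\<in>V. c i w * (g i - g w)\<^sup>2) + (\<Sum>w\<in>V. c j w * (g j - g w)\<^sup>2) - c i j * (g i - g j)\<^sup>2
     \<le> energy g"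
proof -
  let ?t = "\<lambda>u v. c u v * (g u - g v)\<^sup>2"
  let ?R = "\<lambda>u. \<Sum>v\<in>V. ?t u v"
  have t0: "0 \<le> ?t u v" for u v by (simp add: c_nonneg)
  have tsym: "?t u v = ?t v u" for u v by (simp add: c_sym[of u v] power2_commute)
  have split: "(\<Sum>u\<in>V. F u) = F i + F j + (\<Sum>u\<in>V - {i, j}. F u)" for F :: "'a \<Rightarrow> real"
  proof -
    have "(\<Sum>u\<in>V. F u) = F i + (\<Sum>u\<in>V - {i}. F u)" using ij finite_V by (simp add: sum.remove)
    also have "(\<Sum>u\<in>V - {i}. F u) = F j + (\<Sum>u\<in>V - {i} - {j}. F u)"
      using ij finite_V by (intro sum.remove) auto
    finally show ?thesis by (simp add: Diff_insert2[symmetric])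
  qed
  have "(\<Sum>u\<in>V - {i, j}. ?R u) \<ge> (\<Sum>u\<in>V - {i, j}. ?t i u + ?t j u)"
  proof (intro sum_mono)
    fix u
    have "?R u = ?t u i + ?t u j + (\<Sum>v\<in>V - {i, j}. ?t u v)" by (rule split)
    moreover have "0 \<le> (\<Sum>v\<in>V - {i, j}. ?t u v)" by (intro sum_nonneg t0)
    ultimately show "?t i u + ?t j u \<le> ?R u" using tsym[of u i] tsym[of u j] by linarith
  qed
  moreover have "(\<Sum>u\<in>V - {i, j}. ?t i u + ?t j u) = ?R i + ?R j - 2 * ?t i j"
    using split[of "?t i"] split[of "?t j"] tsym[of j i] by (simp add: sum.distrib)
  moreover have "2 * energy g = ?R i + ?R j + (\<Sum>u\<in>V - {i, j}. ?R u)"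
    unfolding energy_def using split[of ?R] by simp
  ultimately show ?thesis by linarith
qed

text \<open>
  By \<open>poincare\<close>, the function \<open>g\<close> is close to some constant \<open>a\<close> in square norm, and each single edge
  carries at most a fraction \<open>\<eta>\<close> of the weight \<open>m\<close>, so the values of \<open>g\<close> around \<open>i\<close> and around \<open>j\<close>
  average to about \<open>a\<close>. The two stars then have energy about \<open>m * ((1 - a)\<^sup>2 + a\<^sup>2)\<close>. The Poincare
  inequality bounds the error by the energy itself, which is why the energy occurs with a factor
  slightly above \<open>1\<close>.
\<close>

lemma energy_lower_bound:
  fixes \<beta> m \<theta> \<delta> \<eta> :: real
  assumes iso: "\<And>S. S \<subseteq> V \<Longrightarrow> S \<noteq> {} \<Longrightarrow> 2 * card S \<le> card V \<Longrightarrow> \<beta> * m * card S \<le> cut S"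
    and pos: "0 < \<beta>" "0 < m" and \<theta>: "0 < \<theta>" "\<theta> \<le> 1" and "\<delta> \<le> 1"
    and wt: "\<And>v. v \<in> V \<Longrightarrow> (1 - \<delta>) * m \<le> weight v" "\<And>v. v \<in> V \<Longrightarrow> weight v \<le> (1 + \<delta>) * m"
    and small: "\<And>u v. u \<in> V \<Longrightarrow> v \<in> V \<Longrightarrow> c u v \<le> \<eta> * m"
    and ij: "i \<in> V" "j \<in> V" "i \<noteq> j" and g: "g i = 1" "g j = 0"
  shows "((1 - \<theta>) * (1 - \<delta>) / 2 - \<eta>) * m \<le> (1 + 8 * \<eta> / (\<theta> * \<beta>\<^sup>2)) * energy g"
proof -
  have "(1 + \<delta>) * m \<le> 2 * m" using \<open>\<delta> \<le> 1\<close> pos by (intro mult_right_mono) auto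
  then have "weight v \<le> 2 * m" if "v \<in> V" for v using wt(2)[OF that] by linarith
  from poincare[OF iso pos this]
  obtain a where a: "(\<Sum>v\<in>V. (g v - a)\<^sup>2) \<le> 4 / (\<beta>\<^sup>2 * m) * energy g" .
  have "\<eta> * m \<ge> 0" using small[OF ij(1,2)] c_nonneg[of i j] by linarith
  \<comment> \<open>\<open>(x + y)\<^sup>2 \<ge> (1 - \<theta>) x\<^sup>2 - y\<^sup>2 / \<theta>\<close>, summed over the edges at \<open>k\<close>\<close>
  have star: "(1 - \<theta>) * (g k - a)\<^sup>2 * ((1 - \<delta>) * m) - 4 * \<eta> / (\<theta> * \<beta>\<^sup>2) * energy g
      \<le> (\<Sum>w\<in>V. c k w * (g k - g w)\<^sup>2)" if k: "k \<in> V" for k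
  proof -
    have "(1 - \<theta>) * (g k - a)\<^sup>2 - 1 / \<theta> * (g w - a)\<^sup>2 \<le> (g k - g w)\<^sup>2" for w
    proof -
      have "0 \<le> \<theta> * ((g k - a) - 1 / \<theta> * (g w - a))\<^sup>2" using \<theta> by simp
      also have "\<dots> = \<theta> * (g k - a)\<^sup>2 - 2 * (g k - a) * (g w - a) + 1 / \<theta> * (g w - a)\<^sup>2"
        using \<theta> by (simp add: power2_eq_square field_simps)
      also have "2 * (g k - a) * (g w - a) = (g k - a)\<^sup>2 + (g w - a)\<^sup>2 - (g k - g w)\<^sup>2"
        by (simp add: power2_eq_square algebra_simps)
      finally show ?thesis using zero_le_power2[of "g w - a"] by (simp only: left_diff_distrib)
    qed
    then have "(\<Sum>w\<in>V. c k w * ((1 - \<theta>) * (g k - a)\<^sup>2 - 1 / \<theta> * (g w - a)\<^sup>2)) \<le> (\<Sum>w\<in>V. c k w * (g k - g w)\<^sup>2)"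
      by (intro sum_mono mult_left_mono c_nonneg)
    also have "(\<Sum>w\<in>V. c k w * ((1 - \<theta>) * (g k - a)\<^sup>2 - 1 / \<theta> * (g w - a)\<^sup>2)) =
        (1 - \<theta>) * (g k - a)\<^sup>2 * weight k - 1 / \<theta> * (\<Sum>w\<in>V. c k w * (g w - a)\<^sup>2)"
      by (simp add: weight_def sum_subtractf sum_distrib_left sum_distrib_right right_diff_distrib mult_ac)
    finally have 1: "(1 - \<theta>) * (g k - a)\<^sup>2 * weight k - 1 / \<theta> * (\<Sum>w\<in>V. c k w * (g w - a)\<^sup>2)
        \<le> (\<Sum>w\<in>V. c k w * (g k - g w)\<^sup>2)" .
    have "(\<Sum>w\<in>V. c k w * (g w - a)\<^sup>2) \<le> (\<Sum>w\<in>V. \<eta> * m * (g w - a)\<^sup>2)"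
      using small k by (intro sum_mono mult_right_mono) auto
    also have "\<dots> = \<eta> * m * (\<Sum>w\<in>V. (g w - a)\<^sup>2)" by (simp add: sum_distrib_left)
    also have "\<dots> \<le> \<eta> * m * (4 / (\<beta>\<^sup>2 * m) * energy g)"
      by (intro mult_left_mono a \<open>\<eta> * m \<ge> 0\<close>)
    also have "\<dots> = 4 * \<eta> / \<beta>\<^sup>2 * energy g" using pos by simp
    finally have "1 / \<theta> * (\<Sum>w\<in>V. c k w * (g w - a)\<^sup>2) \<le> 1 / \<theta> * (4 * \<eta> / \<beta>\<^sup>2 * energy g)"
      using \<theta> by (intro mult_left_mono) auto
    also have "\<dots> = 4 * \<eta> / (\<theta> * \<beta>\<^sup>2) * energy g" by simp
    finally have 2: "1 / \<theta> * (\<Sum>w\<in>V. c k w * (g w - a)\<^sup>2) \<le> 4 * \<eta> / (\<theta> * \<beta>\<^sup>2) * energy g" .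
    have "(1 - \<theta>) * (g k - a)\<^sup>2 * ((1 - \<delta>) * m) \<le> (1 - \<theta>) * (g k - a)\<^sup>2 * weight k"
      using wt(1)[OF k] \<theta> by (intro mult_left_mono) auto
    with 1 2 show ?thesis by linarith
  qed
  have "(1 - \<theta>) * ((1 - \<delta>) * m) * (1 / 2) \<le> (1 - \<theta>) * ((1 - \<delta>) * m) * ((1 - a)\<^sup>2 + (0 - a)\<^sup>2)"
  proof (rule mult_left_mono)
    have "1 / 2 + 2 * (a - 1 / 2)\<^sup>2 = (1 - a)\<^sup>2 + (0 - a)\<^sup>2"
      by (simp add: power2_eq_square algebra_simps)
    then show "1 / 2 \<le> (1 - a)\<^sup>2 + (0 - a)\<^sup>2" using zero_le_power2[of "a - 1/2"] by linarith
  qed (use \<theta> pos \<open>\<delta> \<le> 1\<close> in simp)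
  moreover have "c i j * (g i - g j)\<^sup>2 \<le> \<eta> * m" using small[OF ij(1,2)] g by simp
  moreover note energy_ge_two_stars[OF ij, of g] star[OF ij(1)] star[OF ij(2)]
  ultimately have "(1 - \<theta>) * ((1 - \<delta>) * m) * (1 / 2) - 2 * (4 * \<eta> / (\<theta> * \<beta>\<^sup>2) * energy g) \<le> energy g + \<eta> * m"
    by (simp add: g algebra_simps)
  moreover have "(1 + 8 * \<eta> / (\<theta> * \<beta>\<^sup>2)) * energy g = energy g + 2 * (4 * \<eta> / (\<theta> * \<beta>\<^sup>2) * energy g)"
    by (simp add: distrib_right)
  moreover have "((1 - \<theta>) * (1 - \<delta>) / 2 - \<eta>) * m = (1 - \<theta>) * ((1 - \<delta>) * m) * (1 / 2) - \<eta> * m"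
    by (simp add: left_diff_distrib)
  ultimately show ?thesis by linarith
qed

lemma energy_diff:
  "energy (\<lambda>v. g v - t * f v) = energy g - 2 * t * (\<Sum>u\<in>V. f u * laplacian g u) + t\<^sup>2 * energy f"
proof -
  have "(\<Sum>u\<in>V. \<Sum>v\<in>V. c u v * ((g u - t * f u) - (g v - t * f v))\<^sup>2) =
      (\<Sum>u\<in>V. \<Sum>v\<in>V. c u v * (g u - g v)\<^sup>2 - 2 * t * (c u v * ((f u - f v) * (g u - g v)))
         + t\<^sup>2 * (c u v * (f u - f v)\<^sup>2))"
    by (intro sum.cong refl) (simp add: power2_eq_square algebra_simps)
  also have "\<dots> = (\<Sum>u\<in>V. \<Sum>v\<in>V. c u v * (g u - g v)\<^sup>2)
      - 2 * t * (\<Sum>u\<in>V. \<Sum>v\<in>V. c u v * ((f u - f v) * (g u - g v)))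
      + t\<^sup>2 * (\<Sum>u\<in>V. \<Sum>v\<in>V. c u v * (f u - f v)\<^sup>2)"
    by (simp only: sum.distrib sum_subtractf sum_distrib_left)
  finally show ?thesis by (simp add: green_identity energy_def)
qed

lemma energy_indicator_le:
  assumes "i \<in> V"
  shows "energy (\<lambda>v. if v = i then 1 else 0) \<le> weight i"
proof -
  let ?f = "\<lambda>v. if v = i then 1 else 0 :: real"
  have "energy ?f = laplacian ?f i"
    using assms finite_V by (simp add: energy_eq_laplacian if_distrib[of "\<lambda>x. x * _"] cong: if_cong)
  also have "\<dots> \<le> weight i"
    unfolding laplacian_def weight_def by (intro sum_mono) (simp add: c_nonneg)
  finally show ?thesis .
qed

definition total_weight :: real where
  "total_weight = (\<Sum>v\<in>V. weight v)"

text \<open>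
  The sum of a Laplacian over all vertices vanishes, so its values off \<open>j\<close> determine the one at \<open>j\<close>:
  it is \<open>weight j - total_weight\<close>. The statement pairs this with an arbitrary function \<open>f\<close>.
\<close>

lemma laplacian_hitting:
  assumes "j \<in> V" "\<And>v. v \<in> V \<Longrightarrow> v \<noteq> j \<Longrightarrow> laplacian h v = weight v"
  shows "(\<Sum>u\<in>V. f u * laplacian h u) = (\<Sum>u\<in>V. f u * weight u) - total_weight * f j"
proof -
  have split: "(\<Sum>u\<in>V. F u) = F j + (\<Sum>u\<in>V - {j}. F u)" for F :: "'a \<Rightarrow> real"
    using assms(1) finite_V by (rule sum.remove[rotated])
  have eq: "(\<Sum>u\<in>V - {j}. F u * laplacian h u) = (\<Sum>u\<in>V - {j}. F u * weight u)" for F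
    by (intro sum.cong) (auto simp: assms(2))
  have "laplacian h j = weight j - total_weight"
    using split[of "laplacian h"] split[of weight] eq[of "\<lambda>_. 1"]
    by (simp add: sum_laplacian total_weight_def)
  then have "f j * laplacian h j = f j * weight j - total_weight * f j"
    by (simp add: right_diff_distrib)
  then show ?thesis
    using split[of "\<lambda>u. f u * laplacian h u"] split[of "\<lambda>u. f u * weight u"] eq[of f]
    by linarith
qed

lemma laplacian_minus: "laplacian (\<lambda>v. h v - k v) u = laplacian h u - laplacian k u"
  by (simp add: laplacian_def sum_subtractf[symmetric] algebra_simps)

text \<open>
  The functions \<open>h\<close> and \<open>k\<close> stand for the mean hitting times of \<open>j\<close> and of \<open>i\<close>, so \<open>h i + k j\<close> is the commute
  time. In \<open>\<phi> = h - k\<close> the weights cancel off \<open>i\<close> and \<open>j\<close>, so \<open>\<phi>\<close> is the potential of a current of strength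
  \<open>total_weight\<close> from \<open>i\<close> to \<open>j\<close>: the energy of \<open>\<phi>\<close> is \<open>total_weight\<close> times the commute time.
\<close>

lemma commute_bounds:
  fixes \<beta> m \<theta> \<delta> \<eta> :: real
  assumes iso: "\<And>S. S \<subseteq> V \<Longrightarrow> S \<noteq> {} \<Longrightarrow> 2 * card S \<le> card V \<Longrightarrow> \<beta> * m * card S \<le> cut S"
    and pos: "0 < \<beta>" "0 < m" and \<theta>: "0 < \<theta>" "\<theta> \<le> 1" and \<delta>: "0 \<le> \<delta>" "\<delta> < 1" and "0 \<le> \<eta>"
    and wt: "\<And>v. v \<in> V \<Longrightarrow> (1 - \<delta>) * m \<le> weight v" "\<And>v. v \<in> V \<Longrightarrow> weight v \<le> (1 + \<delta>) * m"
    and small: "\<And>u v. u \<in> V \<Longrightarrow> v \<in> V \<Longrightarrow> c u v \<le> \<eta> * m"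
    and ij: "i \<in> V" "j \<in> V" "i \<noteq> j"
    and h: "h j = 0" "\<And>v. v \<in> V \<Longrightarrow> v \<noteq> j \<Longrightarrow> laplacian h v = weight v"
    and k: "k i = 0" "\<And>v. v \<in> V \<Longrightarrow> v \<noteq> i \<Longrightarrow> laplacian k v = weight v"
  shows "(1 - \<delta>) / (1 + \<delta>) * card V \<le> h i + k j"
    and "((1 - \<theta>) * (1 - \<delta>) / 2 - \<eta>) * (h i + k j) \<le> (1 + \<delta>) * (1 + 8 * \<eta> / (\<theta> * \<beta>\<^sup>2)) * card V"
proof -
  let ?W = total_weight
  define \<phi> where "\<phi> v = h v - k v" for v
  define \<kappa> where "\<kappa> = h i + k j"
  have \<phi>ij: "\<phi> i - \<phi> j = \<kappa>" using h(1) k(1) by (simp add: \<phi>_def \<kappa>_def)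
  have dual: "(\<Sum>u\<in>V. f u * laplacian \<phi> u) = ?W * (f i - f j)" for f
    using laplacian_hitting[OF ij(2) h(2), of f] laplacian_hitting[OF ij(1) k(2), of f]
    unfolding \<phi>_def laplacian_minus by (simp add: right_diff_distrib sum_subtractf)
  have E: "energy \<phi> = ?W * \<kappa>" by (simp add: energy_eq_laplacian dual \<phi>ij)
  have cV: "0 < card V" using ij(1) finite_V by (auto simp: card_gt_0_iff)
  have W: "(1 - \<delta>) * m * card V \<le> ?W" "?W \<le> (1 + \<delta>) * m * card V"
    using sum_mono[of V "\<lambda>_. (1 - \<delta>) * m" weight] sum_mono[of V weight "\<lambda>_. (1 + \<delta>) * m"] wt
    by (simp_all add: total_weight_def mult_ac)
  have W0: "0 < ?W" using W(1) \<delta> pos cV by (intro less_le_trans[OF _ W(1)]) simp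
  have wi: "0 < weight i" using wt(1)[OF ij(1)] \<delta> pos by (intro less_le_trans[OF _ wt(1)[OF ij(1)]]) simp
  show lower: "(1 - \<delta>) / (1 + \<delta>) * card V \<le> h i + k j"
  proof -
    let ?f = "\<lambda>v. if v = i then 1 else 0 :: real"
    \<comment> \<open>the minimiser over \<open>t\<close> of the bound below on the energy of \<open>\<phi> - t f\<close>, as in the proof of Cauchy-Schwarz\<close>
    let ?t = "?W / weight i"
    have "0 \<le> energy (\<lambda>v. \<phi> v - ?t * ?f v)" by (rule energy_nonneg)
    also have "\<dots> = ?W * \<kappa> - 2 * ?t * ?W + ?t\<^sup>2 * energy ?f"
      using ij by (simp only: energy_diff dual E) simp
    also have "\<dots> \<le> ?W * \<kappa> - 2 * ?t * ?W + ?t\<^sup>2 * weight i"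
      using energy_indicator_le[OF ij(1)] by (intro add_left_mono mult_left_mono) auto
    also have "\<dots> = ?W * (\<kappa> - ?t)" using wi by (simp add: power2_eq_square field_simps)
    finally have "?t \<le> \<kappa>" using W0 by (simp add: zero_le_mult_iff)
    have "(1 - \<delta>) / (1 + \<delta>) * card V = (1 - \<delta>) * m * card V / ((1 + \<delta>) * m)"
      using pos by simp
    also have "\<dots> \<le> ?t" using W(1) W0 wi wt(2)[OF ij(1)] pos \<delta> by (intro frac_le) auto
    also note \<open>?t \<le> \<kappa>\<close>
    finally show ?thesis by (simp add: \<kappa>_def)
  qed
  have "0 < (1 - \<delta>) / (1 + \<delta>) * card V" using \<delta> cV by simp
  then have \<kappa>0: "0 < \<kappa>" using lower by (simp add: \<kappa>_def)
  define g where "g v = (\<phi> v - \<phi> j) / \<kappa>" for v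
  have g: "g i = 1" "g j = 0" using \<phi>ij \<kappa>0 by (simp_all add: g_def)
  have "energy g = energy \<phi> / \<kappa>\<^sup>2"
    by (simp add: energy_def g_def diff_divide_distrib[symmetric] power_divide sum_divide_distrib[symmetric])
  also have "\<dots> = ?W / \<kappa>" using \<kappa>0 by (simp add: E power2_eq_square)
  finally have "((1 - \<theta>) * (1 - \<delta>) / 2 - \<eta>) * m \<le> (1 + 8 * \<eta> / (\<theta> * \<beta>\<^sup>2)) * (?W / \<kappa>)"
    using energy_lower_bound[OF iso pos \<theta> _ wt small ij g] \<delta> by simp
  also have "\<dots> \<le> (1 + 8 * \<eta> / (\<theta> * \<beta>\<^sup>2)) * ((1 + \<delta>) * m * card V / \<kappa>)"
    using W(2) \<kappa>0 \<open>0 \<le> \<eta>\<close> \<theta> by (intro mult_left_mono divide_right_mono add_nonneg_nonneg) auto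
  finally have "((1 - \<theta>) * (1 - \<delta>) / 2 - \<eta>) * m * (\<kappa> / m) \<le>
      (1 + 8 * \<eta> / (\<theta> * \<beta>\<^sup>2)) * ((1 + \<delta>) * m * card V / \<kappa>) * (\<kappa> / m)"
    using \<kappa>0 pos by (intro mult_right_mono) auto
  then show "((1 - \<theta>) * (1 - \<delta>) / 2 - \<eta>) * (h i + k j) \<le> (1 + \<delta>) * (1 + 8 * \<eta> / (\<theta> * \<beta>\<^sup>2)) * card V"
    using \<kappa>0 pos by (simp add: \<kappa>_def[symmetric] mult_ac)
qed

end

section \<open>Mean hitting times from survival probabilities\<close>

text \<open>
  Connectedness is stated through cuts, because that is the form in which expansion provides it and
  in which the finiteness of hitting times uses it.
\<close>

locale connected_network = network +
  assumes weight_pos: "v \<in> V \<Longrightarrow> 0 < weight v"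
    and edge_across: "S \<subseteq> V \<Longrightarrow> S \<noteq> {} \<Longrightarrow> S \<noteq> V \<Longrightarrow> \<exists>u\<in>S. \<exists>v\<in>V - S. 0 < c u v"
begin

text \<open>
  \<open>survival j t v\<close> is the probability that the walk with transition probabilities \<open>c v w / weight v\<close>,
  started at \<open>v\<close>, avoids \<open>j\<close> at the times \<open>0, ..., t\<close>.
\<close>

primrec survival :: "'a \<Rightarrow> nat \<Rightarrow> 'a \<Rightarrow> real" where
  "survival j 0 v = (if v = j then 0 else 1)"
| "survival j (Suc t) v = (if v = j then 0 else (\<Sum>w\<in>V. c v w * survival j t w) / weight v)"

definition mean_hitting :: "'a \<Rightarrow> 'a \<Rightarrow> real" where
  "mean_hitting j v = (\<Sum>t. survival j t v)"

lemma survival_target: "survival j t j = 0"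
  by (cases t) auto

lemma survival_nonneg: "v \<in> V \<Longrightarrow> 0 \<le> survival j t v"
  by (induction t arbitrary: v)
     (auto intro!: divide_nonneg_nonneg sum_nonneg mult_nonneg_nonneg c_nonneg less_imp_le[OF weight_pos])

lemma weight_survival:
  assumes "v \<in> V" "v \<noteq> j"
  shows "weight v * survival j (Suc t) v = (\<Sum>w\<in>V. c v w * survival j t w)"
  using weight_pos[OF assms(1)] assms(2) by simp

text \<open>
  Reversibility, as in Kac's formula for return times: after one more step the surviving mass under the
  reversing measure has lost exactly what flows along the edges at \<open>j\<close>.
\<close>

lemma escape_from_target:
  assumes j: "j \<in> V"
  shows "(\<Sum>w\<in>V. c j w * survival j t w) =
    (\<Sum>w\<in>V. weight w * survival j t w) - (\<Sum>w\<in>V. weight w * survival j (Suc t) w)"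
proof -
  have "(\<Sum>v\<in>V. weight v * survival j (Suc t) v) = (\<Sum>v\<in>V - {j}. \<Sum>w\<in>V. c v w * survival j t w)"
    using j finite_V
    by (subst sum.remove[OF finite_V j]) (auto simp del: survival.simps simp: survival_target weight_survival)
  also have "\<dots> = (\<Sum>v\<in>V. \<Sum>w\<in>V. c v w * survival j t w) - (\<Sum>w\<in>V. c j w * survival j t w)"
    by (subst sum.remove[OF finite_V j]) simp
  also have "(\<Sum>v\<in>V. \<Sum>w\<in>V. c v w * survival j t w) = (\<Sum>w\<in>V. weight w * survival j t w)"
    unfolding sum_sym[of "\<lambda>v w. survival j t w"] by (simp add: weight_def sum_distrib_right)
  finally show ?thesis by simp
qed

text \<open>
  The loss in \<open>escape_from_target\<close> telescopes over time, so the survival probabilities are summable at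
  the neighbours of \<open>j\<close>. One step of the recursion passes summability from any vertex other than \<open>j\<close>
  to its neighbours, and a set that contains \<open>j\<close> and is closed under these steps is all of \<open>V\<close>.
\<close>

lemma summable_survival:
  assumes "j \<in> V" "v \<in> V"
  shows "summable (\<lambda>t. survival j t v)"
proof -
  define Q where "Q = {v\<in>V. summable (\<lambda>t. survival j t v)}"
  have "j \<in> Q" using assms(1) by (simp add: Q_def survival_target)
  have "Q = V"
  proof (rule ccontr)
    assume "Q \<noteq> V"
    then obtain u v where uv: "u \<in> Q" "v \<in> V - Q" "0 < c u v"
      using edge_across[of Q] \<open>j \<in> Q\<close> by (metis (no_types, lifting) Q_def empty_iff mem_Collect_eq subsetI)
    have V: "u \<in> V" "v \<in> V" using uv by (auto simp: Q_def)
    have one: "c u v * survival j t v \<le> (\<Sum>w\<in>V. c u w * survival j t w)" for t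
      using V finite_V
      by (intro member_le_sum[of v V "\<lambda>w. c u w * survival j t w"]) (auto intro!: mult_nonneg_nonneg c_nonneg survival_nonneg)
    have "summable (\<lambda>t. c u v * survival j t v)"
    proof (cases "u = j")
      case True
      let ?M = "\<lambda>t. \<Sum>w\<in>V. weight w * survival j t w"
      show ?thesis
      proof (rule summableI_nonneg_bounded)
        show "0 \<le> c u v * survival j t v" for t using V by (intro mult_nonneg_nonneg c_nonneg survival_nonneg)
        fix T
        have "(\<Sum>t<T. c u v * survival j t v) \<le> (\<Sum>t<T. ?M t - ?M (Suc t))"
          using one escape_from_target[OF assms(1)] True by (intro sum_mono) metis
        also have "\<dots> = ?M 0 - ?M T" by (rule sum_lessThan_telescope')
        also have "\<dots> \<le> ?M 0"
          using weight_pos by (simp del: survival.simps add: sum_nonneg survival_nonneg less_imp_le)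
        finally show "(\<Sum>t<T. c u v * survival j t v) \<le> ?M 0" .
      qed
    next
      case False
      show ?thesis
      proof (rule summable_comparison_test')
        show "summable (\<lambda>t. weight u * survival j (Suc t) u)"
          using uv(1) by (intro summable_mult) (simp add: Q_def summable_Suc_iff[of "\<lambda>t. survival j t u"] del: survival.simps)
        show "norm (c u v * survival j t v) \<le> weight u * survival j (Suc t) u" for t
          using one[of t] survival_nonneg[OF V(2), of j t] c_nonneg[of u v]
          unfolding weight_survival[OF V(1) False] by (simp add: abs_mult)
      qed
    qed
    then show False using uv V by (simp add: Q_def summable_cmult_iff)
  qed
  then show ?thesis using assms(2) by (auto simp: Q_def)
qed

lemma mean_hitting_target: "mean_hitting j j = 0"
  by (simp add: mean_hitting_def survival_target)

lemma mean_hitting_nonneg: "j \<in> V \<Longrightarrow> v \<in> V \<Longrightarrow> 0 \<le> mean_hitting j v"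
  unfolding mean_hitting_def by (intro suminf_nonneg summable_survival survival_nonneg)

text \<open>
  The one-step equation: the mean hitting time at \<open>v\<close> is one more than its average over the neighbours,
  multiplied here by the weight of \<open>v\<close>.
\<close>

lemma laplacian_mean_hitting:
  assumes j: "j \<in> V" and v: "v \<in> V" "v \<noteq> j"
  shows "laplacian (mean_hitting j) v = weight v"
proof -
  note summable = summable_survival[OF j]
  have "mean_hitting j v = (\<Sum>t. survival j (Suc t) v) + survival j 0 v"
    unfolding mean_hitting_def by (subst suminf_split_head[OF summable[OF v(1)]]) simp
  then have "weight v * (mean_hitting j v - 1) = weight v * (\<Sum>t. survival j (Suc t) v)"
    using v(2) by (simp del: survival.simps(2))
  also have "\<dots> = (\<Sum>t. weight v * survival j (Suc t) v)"
    using summable[OF v(1)] by (intro suminf_mult[symmetric]) (simp add: summable_Suc_iff[of "\<lambda>t. survival j t v"] del: survival.simps)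
  also have "\<dots> = (\<Sum>t. \<Sum>w\<in>V. c v w * survival j t w)"
    by (simp only: weight_survival[OF v])
  also have "\<dots> = (\<Sum>w\<in>V. \<Sum>t. c v w * survival j t w)"
    by (intro suminf_sum summable_mult summable)
  also have "\<dots> = (\<Sum>w\<in>V. c v w * mean_hitting j w)"
    unfolding mean_hitting_def by (intro sum.cong refl suminf_mult summable)
  finally show ?thesis
    by (simp add: laplacian_def right_diff_distrib sum_subtractf sum_distrib_right[symmetric] weight_def[symmetric])
qed

end

section \<open>The walk on a hypergraph as a walk on a network\<close>

definition vertex_degree :: "nat set set \<Rightarrow> nat \<Rightarrow> nat" where
  "vertex_degree E v = card {e\<in>E. v \<in> e}"

text \<open>
  The multiplicity of the edge \<open>u v\<close> in the multigraph of the walk; it vanishes on the diagonal since the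
  walk never stays put.
\<close>

definition codegree :: "nat set set \<Rightarrow> nat \<Rightarrow> nat \<Rightarrow> real" where
  "codegree E u v = (if u = v then 0 else real (card {e\<in>E. u \<in> e \<and> v \<in> e}))"

definition crossing :: "nat set set \<Rightarrow> nat set \<Rightarrow> nat set set" where
  "crossing E S = {e\<in>E. e \<inter> S \<noteq> {} \<and> e - S \<noteq> {}}"

lemma all_hyperedgesD:
  assumes "e \<in> all_hyperedges d n"
  shows "e \<subseteq> {1..n}" "card e = d" "finite e"
  using assms finite_subset[of e "{1..n}"] by (auto simp: all_hyperedges_def)

lemma finite_all_hyperedges: "finite (all_hyperedges d n)"
  by (rule finite_subset[of _ "Pow {1..n}"]) (auto simp: all_hyperedges_def)

lemma network_codegree: "network {1..n} (codegree E)"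
proof
  show "codegree E u v = codegree E v u" for u v
    by (simp add: codegree_def conj_commute)
qed (simp_all add: codegree_def)

lemma weight_codegree:
  assumes E: "E \<subseteq> all_hyperedges d n" and v: "v \<in> {1..n}"
  shows "network.weight {1..n} (codegree E) v = (real d - 1) * vertex_degree E v"
proof -
  have fin: "finite E" using E finite_all_hyperedges by (rule finite_subset)
  let ?E = "{e\<in>E. v \<in> e}"
  have "network.weight {1..n} (codegree E) v = (\<Sum>w\<in>{1..n} - {v}. real (card {e\<in>E. v \<in> e \<and> w \<in> e}))"
    unfolding network.weight_def[OF network_codegree]
    by (intro sum.mono_neutral_cong_right) (auto simp: codegree_def)
  also have "\<dots> = (\<Sum>w\<in>{1..n} - {v}. \<Sum>e\<in>?E. if w \<in> e then 1 else 0)"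
    using fin by (intro sum.cong refl) (simp add: sum.If_cases Collect_conj_eq Int_assoc)
  also have "\<dots> = (\<Sum>e\<in>?E. \<Sum>w\<in>{1..n} - {v}. if w \<in> e then 1 else 0)" by (rule sum.swap)
  also have "\<dots> = (\<Sum>e\<in>?E. real d - 1)"
  proof (intro sum.cong refl)
    fix e assume e: "e \<in> ?E"
    then have "e \<in> all_hyperedges d n" using E by auto
    note e' = all_hyperedgesD[OF this]
    have "({1..n} - {v}) \<inter> {w. w \<in> e} = e - {v}" using e'(1) by auto
    then have "(\<Sum>w\<in>{1..n} - {v}. if w \<in> e then 1 else 0 :: real) = card (e - {v})"
      by (simp add: sum.If_cases)
    also have "\<dots> = real d - 1"
    proof -
      have "card e > 0" using e e'(3) by (auto simp: card_gt_0_iff)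
      then show ?thesis using e e' by (auto simp: card_Diff_singleton of_nat_diff simp del: One_nat_def)
    qed
    finally show "(\<Sum>w\<in>{1..n} - {v}. if w \<in> e then 1 else 0) = real d - 1" .
  qed
  finally show ?thesis by (simp add: vertex_degree_def mult.commute)
qed

text \<open>
  A hyperedge that crosses \<open>S\<close> contains at least one pair with one vertex on either side.
\<close>

lemma crossing_le_cut:
  assumes E: "E \<subseteq> all_hyperedges d n" and S: "S \<subseteq> {1..n}"
  shows "real (card (crossing E S)) \<le> network.cut {1..n} (codegree E) S"
proof -
  have fin: "finite E" "finite S" using E S finite_all_hyperedges by (auto intro: finite_subset)
  let ?P = "S \<times> ({1..n} - S)"
  have "crossing E S \<subseteq> (\<Union>(u, v)\<in>?P. {e\<in>E. u \<in> e \<and> v \<in> e})"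
  proof
    fix e assume e: "e \<in> crossing E S"
    then have "e \<subseteq> {1..n}" using E all_hyperedgesD(1)[of e d n] by (auto simp: crossing_def)
    moreover from e obtain u v where "u \<in> e" "u \<in> S" "v \<in> e" "v \<notin> S" "e \<in> E" by (auto simp: crossing_def)
    ultimately show "e \<in> (\<Union>(u, v)\<in>?P. {e\<in>E. u \<in> e \<and> v \<in> e})" by auto
  qed
  then have "card (crossing E S) \<le> card (\<Union>(u, v)\<in>?P. {e\<in>E. u \<in> e \<and> v \<in> e})"
    using fin by (intro card_mono) auto
  also have "\<dots> \<le> (\<Sum>(u, v)\<in>?P. card {e\<in>E. u \<in> e \<and> v \<in> e})"
    using fin by (intro order_trans[OF card_UN_le]) (auto simp: case_prod_unfold)
  finally have "real (card (crossing E S)) \<le> (\<Sum>(u, v)\<in>?P. real (card {e\<in>E. u \<in> e \<and> v \<in> e}))"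
    by (simp add: case_prod_unfold flip: of_nat_sum)
  also have "\<dots> = network.cut {1..n} (codegree E) S"
    unfolding network.cut_def[OF network_codegree] sum.cartesian_product
    by (intro sum.cong) (auto simp: codegree_def)
  finally show ?thesis .
qed

lemma pmf_walk_step:
  assumes E: "E \<subseteq> all_hyperedges d n" and d: "d \<ge> 2" and v: "v \<in> {1..n}" "0 < vertex_degree E v"
  shows "pmf (walk_step E v) w = codegree E v w / network.weight {1..n} (codegree E) v"
proof -
  have fin: "finite E" using E finite_all_hyperedges by (rule finite_subset)
  let ?E = "{e\<in>E. v \<in> e}"
  have "pmf (walk_step E v) w = (\<Sum>e\<in>?E. pmf (pmf_of_set (e - {v})) w) / card ?E"
    unfolding walk_step_def using v(2) fin
    by (intro pmf_bind_pmf_of_set) (auto simp: vertex_degree_def card_gt_0_iff)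
  also have "(\<Sum>e\<in>?E. pmf (pmf_of_set (e - {v})) w) =
      (\<Sum>e\<in>?E. (if w \<in> e \<and> w \<noteq> v then 1 else 0) / (real d - 1))"
  proof (intro sum.cong refl)
    fix e assume e: "e \<in> ?E"
    then have "e \<in> all_hyperedges d n" using E by auto
    note e' = all_hyperedgesD[OF this]
    have c: "card (e - {v}) = d - 1" using e e' by (auto simp: card_Diff_singleton)
    then have "e - {v} \<noteq> {}" using d by (intro notI) simp
    then show "pmf (pmf_of_set (e - {v})) w = (if w \<in> e \<and> w \<noteq> v then 1 else 0) / (real d - 1)"
      using e' d c by (simp add: indicator_def of_nat_diff)
  qed
  also have "\<dots> = codegree E v w / (real d - 1)"
    using fin by (auto simp: sum_divide_distrib[symmetric] sum.If_cases codegree_def Collect_conj_eq Int_assoc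
        intro!: arg_cong[where f = card])
  finally show ?thesis by (simp add: weight_codegree[OF E v(1)] vertex_degree_def del: One_nat_def)
qed

text \<open>
  This reduces expected hitting times to the probabilities that the walk has not yet reached \<open>j\<close>.
\<close>

lemma hitting_time_eq_suminf:
  "hitting_time X j = (\<Sum>t. if \<forall>s\<le>t. X s \<noteq> j then 1 else 0)"
proof (cases "\<exists>t. X t = j")
  case True
  define T where "T = (LEAST t. X t = j)"
  have T: "X T = j" unfolding T_def by (rule LeastI_ex[OF True])
  have less: "X s \<noteq> j" if "s < T" for s using not_less_Least[of s "\<lambda>t. X t = j"] that by (auto simp: T_def)
  have "hitting_time X j = of_nat T"
    unfolding hitting_time_def
  proof (rule antisym)
    show "(INF t\<in>{t. X t = j}. of_nat t) \<le> (of_nat T :: ennreal)" using T by (intro INF_lower) simp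
    show "(of_nat T :: ennreal) \<le> (INF t\<in>{t. X t = j}. of_nat t)"
      using less by (intro INF_greatest) (auto simp: not_less[symmetric])
  qed
  also have "\<dots> = (\<Sum>t\<in>{..<T}. if \<forall>s\<le>t. X s \<noteq> j then 1 else 0)"
    using less by (subst sum.cong[of _ "{..<T}" _ "\<lambda>_. 1"]) auto
  also have "\<dots> = (\<Sum>t. if \<forall>s\<le>t. X s \<noteq> j then 1 else 0)"
    using T by (intro suminf_finite[symmetric]) (auto simp: not_less)
  finally show ?thesis .
next
  case False
  then have "(\<Sum>t. if \<forall>s\<le>t. X s \<noteq> j then 1 else 0) = (SUP n. of_nat n :: ennreal)"
    by (simp add: suminf_eq_SUP)
  then show ?thesis using False by (simp add: hitting_time_def ennreal_SUP_of_nat_eq_top)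
qed

text \<open>
  Condition on the first random map: both sides satisfy the same recursion in \<open>t\<close>.
\<close>

lemma emeasure_survival:
  assumes E: "E \<subseteq> all_hyperedges d n" and d: "d \<ge> 2"
    and conn: "connected_network {1..n} (codegree E)" and v: "v \<in> {1..n}"
  shows "emeasure (walk_space n E) {\<omega> \<in> space (walk_space n E). \<forall>s\<le>t. walk v \<omega> s \<noteq> j} =
    ennreal (connected_network.survival {1..n} (codegree E) j t v)"
  using v
proof (induction t arbitrary: v)
  interpret connected_network "{1..n}" "codegree E" by (rule conn)
  interpret S: prob_space "walk_space n E"
    unfolding walk_space_def by (intro prob_space.prob_space_stream_space measure_pmf.prob_space_axioms)
  {
    case 0
    show ?case using S.emeasure_space_1 by (auto simp del: One_nat_def)
  next
    case (Suc t)
    let ?p = "Pi_pmf {1..n} 0 (walk_step E)"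
    let ?M = "measure_pmf ?p"
    let ?A = "\<lambda>v t. {\<omega> \<in> space (walk_space n E). \<forall>s\<le>t. walk v \<omega> s \<noteq> j}"
    have A: "?A w s \<in> sets (walk_space n E)" for w s by measurable
    have deg: "0 < vertex_degree E v" using weight_pos[OF Suc.prems] weight_codegree[OF E Suc.prems]
      by (auto intro: Nat.gr0I)
    have pmf: "pmf (walk_step E v) w = codegree E v w / weight v" for w
      by (rule pmf_walk_step[OF E d Suc.prems deg])
    have supp: "set_pmf (walk_step E v) \<subseteq> {1..n}"
    proof
      fix w assume "w \<in> set_pmf (walk_step E v)"
      then have "codegree E v w \<noteq> 0" by (auto simp: set_pmf_iff pmf)
      then have "{e\<in>E. v \<in> e \<and> w \<in> e} \<noteq> {}" unfolding codegree_def by (metis card.empty of_nat_0)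
      then show "w \<in> {1..n}" using E all_hyperedgesD(1) by blast
    qed
    have proj: "map_pmf (\<lambda>f. f v) ?p = walk_step E v"
      using Suc.prems by (subst Pi_pmf_component) auto
    have split: "(\<forall>s\<le>Suc t. walk v (f ## \<omega>) s \<noteq> j) \<longleftrightarrow>
        v \<noteq> j \<and> (\<forall>s\<le>t. walk (f v) \<omega> s \<noteq> j)" for f \<omega>
      unfolding less_Suc_eq_le[symmetric] All_less_Suc2 by (auto simp: walk_Suc_shift simp del: walk.simps(2))
    have "emeasure (walk_space n E) (?A v (Suc t)) =
        (\<integral>\<^sup>+f. emeasure (walk_space n E) {\<omega> \<in> space (walk_space n E). f ## \<omega> \<in> ?A v (Suc t)} \<partial>?M)"
      using A[of "Suc t" v] unfolding walk_space_def
      by (rule prob_space.emeasure_stream_space[OF measure_pmf.prob_space_axioms])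
    also have "\<dots> = (\<integral>\<^sup>+f. (if v = j then 0 else emeasure (walk_space n E) (?A (f v) t)) \<partial>?M)"
    proof (rule nn_integral_cong)
      fix f
      have "{\<omega> \<in> space (walk_space n E). f ## \<omega> \<in> ?A v (Suc t)} = (if v = j then {} else ?A (f v) t)"
        by (auto simp: split walk_space_def space_stream_space simp del: walk.simps)
      then show "emeasure (walk_space n E) {\<omega> \<in> space (walk_space n E). f ## \<omega> \<in> ?A v (Suc t)} =
          (if v = j then 0 else emeasure (walk_space n E) (?A (f v) t))" by simp
    qed
    also have "\<dots> = ennreal (survival j (Suc t) v)"
    proof (cases "v = j")
      case True
      then show ?thesis by (simp del: One_nat_def)
    next
      case False
      have "(\<integral>\<^sup>+f. emeasure (walk_space n E) (?A (f v) t) \<partial>?M) =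
          (\<integral>\<^sup>+w. emeasure (walk_space n E) (?A w t) \<partial>measure_pmf (walk_step E v))"
        unfolding proj[symmetric] by simp
      also have "\<dots> = (\<Sum>w\<in>{1..n}. emeasure (walk_space n E) (?A w t) * ennreal (pmf (walk_step E v) w))"
        using supp by (intro nn_integral_measure_pmf_support) (auto simp: set_pmf_iff)
      also have "\<dots> = (\<Sum>w\<in>{1..n}. ennreal (codegree E v w * survival j t w / weight v))"
      proof (intro sum.cong refl)
        fix w assume w: "w \<in> {1..n}"
        show "emeasure (walk_space n E) (?A w t) * ennreal (pmf (walk_step E v) w) =
            ennreal (codegree E v w * survival j t w / weight v)"
          unfolding Suc.IH[OF w] pmf
          using survival_nonneg[OF w, of j t] c_nonneg[of v w] weight_pos[OF Suc.prems]
          by (simp add: ennreal_mult'[symmetric] mult.commute)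
      qed
      also have "\<dots> = ennreal (\<Sum>w\<in>{1..n}. codegree E v w * survival j t w / weight v)"
        using survival_nonneg c_nonneg weight_pos[OF Suc.prems]
        by (intro sum_ennreal divide_nonneg_nonneg mult_nonneg_nonneg) auto
      finally show ?thesis using False by (simp add: sum_divide_distrib del: One_nat_def)
    qed
    finally show ?case .
  }
qed

lemma expected_hitting_time_eq:
  assumes E: "E \<subseteq> all_hyperedges d n" and d: "d \<ge> 2"
    and conn: "connected_network {1..n} (codegree E)" and ij: "i \<in> {1..n}" "j \<in> {1..n}"
  shows "expected_hitting_time n E i j = ennreal (connected_network.mean_hitting {1..n} (codegree E) j i)"
proof -
  interpret connected_network "{1..n}" "codegree E" by (rule conn)
  let ?A = "\<lambda>t. {\<omega> \<in> space (walk_space n E). \<forall>s\<le>t. walk i \<omega> s \<noteq> j}"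
  have A: "?A t \<in> sets (walk_space n E)" for t by measurable
  have "expected_hitting_time n E i j = (\<integral>\<^sup>+\<omega>. (\<Sum>t. indicator (?A t) \<omega>) \<partial>walk_space n E)"
    unfolding expected_hitting_time_def hitting_time_eq_suminf
    by (intro nn_integral_cong suminf_cong) (auto simp: indicator_def)
  also have "\<dots> = (\<Sum>t. ennreal (survival j t i))"
    using A by (subst nn_integral_suminf) (simp_all add: emeasure_survival[OF E d conn ij(1)])
  also have "\<dots> = ennreal (mean_hitting j i)"
    unfolding mean_hitting_def using ij by (intro suminf_ennreal2 survival_nonneg summable_survival)
  finally show ?thesis .
qed

text \<open>
  The vertices that chains from \<open>u\<close> reach form a set that no hyperedge crosses.
\<close>

lemma connected_hypergraphI:
  assumes cross: "\<And>S. S \<subseteq> {1..n} \<Longrightarrow> S \<noteq> {} \<Longrightarrow> S \<noteq> {1..n} \<Longrightarrow> crossing E S \<noteq> {}"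
    and E: "E \<subseteq> all_hyperedges d n"
  shows "connected_hypergraph n E"
  unfolding connected_hypergraph_def
proof (intro ballI impI)
  fix u v assume uv: "u \<in> {1..n}" "v \<in> {1..n}" "u \<noteq> v"
  let ?chain = "\<lambda>w es. es \<noteq> [] \<and> set es \<subseteq> E \<and> u \<in> hd es \<and> w \<in> last es \<and>
              successively (\<lambda>e e'. e \<inter> e' \<noteq> {}) es"
  define R where "R = insert u {w\<in>{1..n}. \<exists>es. ?chain w es}"
  have "R = {1..n}"
  proof (rule ccontr)
    assume "R \<noteq> {1..n}"
    moreover have "R \<subseteq> {1..n}" "R \<noteq> {}" using uv by (auto simp: R_def)
    ultimately obtain e where "e \<in> crossing E R" using cross[of R] by blast
    then obtain x y where e: "e \<in> E" "x \<in> e" "x \<in> R" "y \<in> e" "y \<notin> R"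
      by (auto simp: crossing_def)
    have "y \<in> {1..n}" using e E all_hyperedgesD(1) by blast
    moreover have "\<exists>es. ?chain y es"
    proof (cases "x = u")
      case True
      then show ?thesis using e by (intro exI[of _ "[e]"]) auto
    next
      case False
      then obtain es where "?chain x es" using e(3) by (auto simp: R_def)
      then have "?chain y (es @ [e])" using e by (auto simp: successively_append_iff)
      then show ?thesis by blast
    qed
    ultimately show False using e(5) by (simp add: R_def)
  qed
  then show "\<exists>es. ?chain v es" using uv by (auto simp: R_def)
qed

section \<open>Exponential tail bounds for random hypergraphs\<close>

text \<open>
  The Cramer rate function of the Poisson distribution with mean \<open>1\<close>; it vanishes only at \<open>1\<close>.
\<close>

definition rate :: "real \<Rightarrow> real" where
  "rate x = x * ln x - x + 1"

lemma rate_pos: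
  assumes "0 < x" "x \<noteq> 1"
  shows "0 < rate x"
proof -
  have "ln (inverse x) \<noteq> inverse x - 1"
    using ln_eq_minus_one[of "inverse x"] assms by (metis inverse_1 inverse_inverse_eq inverse_positive_iff_positive)
  with ln_le_minus_one[of "inverse x"] assms(1) have "- ln x < inverse x - 1"
    by (simp add: ln_inverse)
  then have "x * (- ln x) < x * (inverse x - 1)" using assms(1) by (rule mult_strict_left_mono)
  then show ?thesis using assms(1) by (simp add: rate_def right_diff_distrib)
qed

lemma set_random_hypergraph: "E \<in> set_pmf (random_hypergraph d n p) \<Longrightarrow> E \<subseteq> all_hyperedges d n"
  by (auto simp: random_hypergraph_def)

lemma moment_generating:
  fixes p z :: real
  assumes p: "0 \<le> p" "p \<le> 1" and T: "T \<subseteq> all_hyperedges d n" and z: "0 < z"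
  shows "measure_pmf.expectation (random_hypergraph d n p) (\<lambda>E. z ^ card (E \<inter> T)) \<le> exp (p * card T * (z - 1))"
proof -
  let ?O = "all_hyperedges d n"
  let ?f = "\<lambda>e b. if e \<in> T \<and> b then z else 1 :: real"
  have power: "z ^ card ({e\<in>?O. y e} \<inter> T) = (\<Prod>e\<in>?O. ?f e (y e))" for y
  proof -
    have "{e\<in>?O. y e} \<inter> T = ?O \<inter> {e. e \<in> T \<and> y e}" by auto
    then show ?thesis by (simp add: prod.If_cases finite_all_hyperedges)
  qed
  have "measure_pmf.expectation (random_hypergraph d n p) (\<lambda>E. z ^ card (E \<inter> T)) =
      measure_pmf.expectation (Pi_pmf ?O False (\<lambda>_. bernoulli_pmf p)) (\<lambda>y. \<Prod>e\<in>?O. ?f e (y e))"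
    by (simp add: random_hypergraph_def power)
  also have "\<dots> = (\<Prod>e\<in>?O. measure_pmf.expectation (bernoulli_pmf p) (?f e))"
    using z by (intro expectation_prod_Pi_pmf finite_all_hyperedges integrable_measure_pmf_finite) auto
  also have "\<dots> = (\<Prod>e\<in>?O. if e \<in> T then 1 + p * (z - 1) else 1)"
    using p by (intro prod.cong refl) (auto simp: algebra_simps)
  also have "\<dots> = (1 + p * (z - 1)) ^ card T"
    using T by (simp add: prod.If_cases finite_all_hyperedges Int_absorb1)
  also have "\<dots> \<le> exp (p * (z - 1)) ^ card T"
  proof (rule power_mono)
    have "p * (1 - z) \<le> 1 * 1" if "z \<le> 1" using p z that by (intro mult_mono) auto
    moreover have "0 \<le> p * (z - 1)" if "1 \<le> z" using p that by simp
    ultimately show "0 \<le> 1 + p * (z - 1)" by (cases "z \<le> 1") (auto simp: algebra_simps)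
  qed (rule exp_ge_add_one_self)
  also have "\<dots> = exp (p * card T * (z - 1))" by (simp add: exp_of_nat_mult[symmetric] mult_ac)
  finally show ?thesis .
qed

text \<open>
  Both Chernoff bounds are instances: \<open>z \<ge> 1\<close> for the upper tail and \<open>z \<le> 1\<close> for the lower.
\<close>

lemma exponential_markov:
  fixes p z a :: real
  assumes p: "0 \<le> p" "p \<le> 1" and T: "T \<subseteq> all_hyperedges d n" and z: "0 < z"
    and A: "\<And>E. E \<in> A \<Longrightarrow> z powr a \<le> z ^ card (E \<inter> T)"
  shows "measure_pmf.prob (random_hypergraph d n p) A \<le> exp (p * card T * (z - 1) - a * ln z)"
proof -
  let ?H = "random_hypergraph d n p"
  have fin: "finite (set_pmf ?H)"
    by (rule finite_subset[of _ "Pow (all_hyperedges d n)"]) (auto dest: set_random_hypergraph simp: finite_all_hyperedges)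
  have "measure_pmf.prob ?H A \<le> measure_pmf.prob ?H {E \<in> space ?H. z powr a \<le> z ^ card (E \<inter> T)}"
    using A by (intro measure_pmf.finite_measure_mono) auto
  also have "\<dots> \<le> measure_pmf.expectation ?H (\<lambda>E. z ^ card (E \<inter> T)) / z powr a"
    using z fin by (intro integral_Markov_inequality_measure[of _ _ "{}"] integrable_measure_pmf_finite) auto
  also have "\<dots> \<le> exp (p * card T * (z - 1)) / z powr a"
    using moment_generating[OF p T z] by (intro divide_right_mono) auto
  also have "\<dots> = exp (p * card T * (z - 1) - a * ln z)"
    using z by (simp add: powr_def exp_diff)
  finally show ?thesis .
qed

lemma chernoff_upper:
  fixes a p z :: real
  assumes "0 \<le> p" "p \<le> 1" "T \<subseteq> all_hyperedges d n" "1 \<le> z"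
  shows "measure_pmf.prob (random_hypergraph d n p) {E. a \<le> card (E \<inter> T)} \<le> exp (p * card T * (z - 1) - a * ln z)"
  using assms by (intro exponential_markov) (auto simp: powr_realpow[symmetric] intro!: powr_mono)

lemma chernoff_lower:
  fixes a p z :: real
  assumes "0 \<le> p" "p \<le> 1" "T \<subseteq> all_hyperedges d n" "0 < z" "z \<le> 1"
  shows "measure_pmf.prob (random_hypergraph d n p) {E. card (E \<inter> T) \<le> a} \<le> exp (p * card T * (z - 1) - a * ln z)"
  using assms by (intro exponential_markov) (auto simp: powr_realpow[symmetric] intro!: powr_mono')

section \<open>Counting hyperedges\<close>

lemma card_subsets_containing:
  assumes "finite V" "A \<subseteq> V"
  shows "card {e. e \<subseteq> V \<and> card e = k + card A \<and> A \<subseteq> e} = (card V - card A) choose k"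
proof -
  have fin: "finite A" using assms by (auto intro: finite_subset)
  have "bij_betw (\<lambda>e. e \<union> A) {e. e \<subseteq> V - A \<and> card e = k} {e. e \<subseteq> V \<and> card e = k + card A \<and> A \<subseteq> e}"
  proof (rule bij_betw_byWitness[where f' = "\<lambda>e. e - A"])
    show "(\<lambda>e. e \<union> A) ` {e. e \<subseteq> V - A \<and> card e = k} \<subseteq> {e. e \<subseteq> V \<and> card e = k + card A \<and> A \<subseteq> e}"
    proof safe
      fix e assume "e \<subseteq> V - A"
      then have "finite e" "e \<inter> A = {}" using assms by (auto intro: finite_subset)
      then show "card (e \<union> A) = card e + card A" using fin by (intro card_Un_disjoint)
    qed (use assms in auto)
    show "(\<lambda>e. e - A) ` {e. e \<subseteq> V \<and> card e = k + card A \<and> A \<subseteq> e} \<subseteq> {e. e \<subseteq> V - A \<and> card e = k}"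
      using fin by (auto simp: card_Diff_subset)
  qed auto
  then have "card {e. e \<subseteq> V \<and> card e = k + card A \<and> A \<subseteq> e} = card {e. e \<subseteq> V - A \<and> card e = k}"
    by (simp add: bij_betw_same_card)
  also have "\<dots> = (card V - card A) choose k"
    using assms fin by (subst n_subsets) (auto simp: card_Diff_subset)
  finally show ?thesis .
qed

lemma card_star:
  assumes "d \<ge> 1" "v \<in> {1..n}"
  shows "card {e\<in>all_hyperedges d n. v \<in> e} = (n - 1) choose (d - 1)"
  using card_subsets_containing[of "{1..n}" "{v}" "d - 1"] assms
  by (simp add: all_hyperedges_def conj_ac)

lemma card_double_star:
  assumes "d \<ge> 2" "u \<in> {1..n}" "v \<in> {1..n}" "u \<noteq> v"
  shows "card {e\<in>all_hyperedges d n. u \<in> e \<and> v \<in> e} = (n - 2) choose (d - 2)"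
proof -
  have c: "card {u, v} = 2" "d - 2 + 2 = d" using assms by auto
  then have "card {e. e \<subseteq> {1..n} \<and> card e = d \<and> {u, v} \<subseteq> e} = (n - 2) choose (d - 2)"
    using card_subsets_containing[of "{1..n}" "{u, v}" "d - 2", unfolded c] assms by simp
  then show ?thesis by (simp add: all_hyperedges_def conj_ac)
qed

lemma binomial_half_le:
  assumes "2 * a \<le> b" "0 < k"
  shows "2 * (a choose k) \<le> b choose k"
proof -
  have "k * (2 * (a choose k)) = 2 * a * ((a - 1) choose (k - 1))"
    using times_binomial_minus1_eq[OF assms(2), of a] by simp
  also have "\<dots> \<le> b * ((b - 1) choose (k - 1))"
    using assms by (intro mult_le_mono binomial_right_mono) auto
  also have "\<dots> = k * (b choose k)" using times_binomial_minus1_eq[OF assms(2), of b] by simp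
  finally show ?thesis using assms(2) by simp
qed

text \<open>
  Fix a vertex \<open>v\<close> of \<open>S\<close>. At most half of the hyperedges at \<open>v\<close> stay inside \<open>S\<close>, since \<open>S\<close> contains at
  most half of the vertices; all others cross. Summing over \<open>v\<close> counts a crossing hyperedge at
  most \<open>d\<close> times.
\<close>

lemma card_crossing_ge:
  assumes d: "d \<ge> 2" and S: "S \<subseteq> {1..n}" "2 * card S \<le> n"
  shows "card S * ((n - 1) choose (d - 1)) \<le> 2 * d * card (crossing (all_hyperedges d n) S)"
proof (cases "S = {}")
  case False
  let ?O = "all_hyperedges d n"
  let ?C = "crossing ?O S"
  let ?N = "(n - 1) choose (d - 1)"
  have fin: "finite S" "finite ?C"
    using S finite_all_hyperedges[of d n] by (auto simp: crossing_def intro: finite_subset)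
  have "0 < card S" using False fin by (simp add: card_gt_0_iff)
  have half: "2 * ((card S - 1) choose (d - 1)) \<le> ?N"
    using S(2) d \<open>0 < card S\<close> by (intro binomial_half_le) auto
  have star: "?N \<le> 2 * card {e\<in>?C. v \<in> e}" if v: "v \<in> S" for v
  proof -
    have "{e\<in>?O. v \<in> e} \<subseteq> {e\<in>?C. v \<in> e} \<union> {e. e \<subseteq> S \<and> card e = (d - 1) + card {v} \<and> {v} \<subseteq> e}"
      using v d by (auto simp: crossing_def all_hyperedges_def)
    then have "card {e\<in>?O. v \<in> e} \<le> card ({e\<in>?C. v \<in> e} \<union> {e. e \<subseteq> S \<and> card e = (d - 1) + card {v} \<and> {v} \<subseteq> e})"
      using fin by (intro card_mono) (auto intro: finite_subset[of _ "Pow S"])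
    also have "\<dots> \<le> card {e\<in>?C. v \<in> e} + ((card S - 1) choose (d - 1))"
      using card_subsets_containing[OF fin(1), of "{v}" "d - 1"] v
      by (intro order_trans[OF card_Un_le]) simp
    finally show ?thesis using half d v S(1) by (subst (asm) card_star) auto
  qed
  have "card S * ?N \<le> (\<Sum>v\<in>S. 2 * card {e\<in>?C. v \<in> e})"
    using sum_mono[of S "\<lambda>_. ?N", OF star] by simp
  also have "\<dots> = 2 * (\<Sum>v\<in>S. \<Sum>e\<in>?C. if v \<in> e then 1 else 0)"
    using fin by (simp add: sum.If_cases sum_distrib_left Collect_conj_eq)
  also have "(\<Sum>v\<in>S. \<Sum>e\<in>?C. if v \<in> e then 1 else 0) = (\<Sum>e\<in>?C. \<Sum>v\<in>S. if v \<in> e then 1 else 0 :: nat)"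
    by (rule sum.swap)
  also have "\<dots> \<le> (\<Sum>e\<in>?C. d)"
  proof (rule sum_mono)
    fix e assume "e \<in> ?C"
    then have "card e = d" "finite e" using all_hyperedgesD[of e d n] by (auto simp: crossing_def)
    then show "(\<Sum>v\<in>S. if v \<in> e then 1 else 0) \<le> d"
      using fin card_mono[of e "S \<inter> e"] by (simp add: sum.If_cases)
  qed
  finally show ?thesis by (simp add: mult_ac)
qed simp

section \<open>Pseudorandom hypergraphs\<close>

text \<open>
  In the application \<open>\<mu>\<close> is the expected degree of a vertex. By \<open>card_crossing_ge\<close> the expected number
  of hyperedges that cross \<open>S\<close> is at least \<open>\<mu> / (2 * d) * card S\<close>; the last condition asks for half
  of this.
\<close>

definition pseudorandom :: "nat \<Rightarrow> nat \<Rightarrow> real \<Rightarrow> real \<Rightarrow> real \<Rightarrow> nat set set \<Rightarrow> bool" where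
  "pseudorandom d n \<mu> \<delta> \<eta> E \<longleftrightarrow>
     (\<forall>v\<in>{1..n}. (1 - \<delta>) * \<mu> \<le> real (vertex_degree E v) \<and> real (vertex_degree E v) \<le> (1 + \<delta>) * \<mu>) \<and>
     (\<forall>u\<in>{1..n}. \<forall>v\<in>{1..n}. codegree E u v \<le> \<eta> * \<mu>) \<and>
     (\<forall>S. S \<subseteq> {1..n} \<longrightarrow> S \<noteq> {} \<longrightarrow> 2 * card S \<le> n \<longrightarrow> \<mu> / (4 * real d) * card S \<le> real (card (crossing E S)))"

lemma sum_power_card:
  assumes "finite V"
  shows "(\<Sum>S\<in>Pow V - {{}}. q ^ card S) = (1 + q :: real) ^ card V - 1"
proof -
  have "(\<Prod>x\<in>V. q + 1) = (\<Sum>S\<in>Pow V. (\<Prod>x\<in>S. q) * (\<Prod>x\<in>V - S. 1))"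
    by (rule prod_add[OF assms])
  then have "(1 + q) ^ card V = (\<Sum>S\<in>Pow V. q ^ card S)" by (simp add: add.commute)
  also have "\<dots> = 1 + (\<Sum>S\<in>Pow V - {{}}. q ^ card S)"
    using assms by (subst sum.remove[of _ "{}"]) auto
  finally show ?thesis by simp
qed

lemma prob_not_degree:
  fixes p \<delta> \<mu> :: real
  assumes d: "d \<ge> 2" and p: "0 \<le> p" "p \<le> 1" and \<delta>: "0 < \<delta>" "\<delta> < 1"
    and \<mu>: "\<mu> = p * real ((n - 1) choose (d - 1))" and v: "v \<in> {1..n}"
  shows "measure_pmf.prob (random_hypergraph d n p) {E. \<not> ((1 - \<delta>) * \<mu> \<le> real (vertex_degree E v) \<and> real (vertex_degree E v) \<le> (1 + \<delta>) * \<mu>)}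
    \<le> exp (- rate (1 - \<delta>) * \<mu>) + exp (- rate (1 + \<delta>) * \<mu>)"
proof -
  let ?H = "random_hypergraph d n p"
  let ?T = "{e\<in>all_hyperedges d n. v \<in> e}"
  have \<mu>T: "p * card ?T = \<mu>" using card_star[of d v n] d v by (simp add: \<mu>)
  have deg: "vertex_degree E v = card (E \<inter> ?T)" if "E \<in> set_pmf ?H" for E
    using set_random_hypergraph[OF that] by (auto simp: vertex_degree_def intro!: arg_cong[where f = card])
  have "measure_pmf.prob ?H {E. \<not> ((1 - \<delta>) * \<mu> \<le> real (vertex_degree E v) \<and> real (vertex_degree E v) \<le> (1 + \<delta>) * \<mu>)} \<le>
      measure_pmf.prob ?H ({E. card (E \<inter> ?T) \<le> (1 - \<delta>) * \<mu>} \<union> {E. (1 + \<delta>) * \<mu> \<le> card (E \<inter> ?T)})"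
    by (intro measure_pmf.finite_measure_mono_AE) (auto simp: AE_measure_pmf_iff deg)
  also have "\<dots> \<le> measure_pmf.prob ?H {E. card (E \<inter> ?T) \<le> (1 - \<delta>) * \<mu>} +
      measure_pmf.prob ?H {E. (1 + \<delta>) * \<mu> \<le> card (E \<inter> ?T)}"
    by (rule measure_Un_le) auto
  also have "\<dots> \<le> exp (p * card ?T * (1 - \<delta> - 1) - (1 - \<delta>) * \<mu> * ln (1 - \<delta>)) +
      exp (p * card ?T * (1 + \<delta> - 1) - (1 + \<delta>) * \<mu> * ln (1 + \<delta>))"
    using p \<delta> by (intro add_mono chernoff_lower chernoff_upper) auto
  also have "p * card ?T * (1 - \<delta> - 1) - (1 - \<delta>) * \<mu> * ln (1 - \<delta>) = - rate (1 - \<delta>) * \<mu>"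
    unfolding \<mu>T rate_def by (simp add: algebra_simps)
  also have "p * card ?T * (1 + \<delta> - 1) - (1 + \<delta>) * \<mu> * ln (1 + \<delta>) = - rate (1 + \<delta>) * \<mu>"
    unfolding \<mu>T rate_def by (simp add: algebra_simps)
  finally show ?thesis .
qed

text \<open>
  The expected codegree of two distinct vertices is
  \<open>\<mu> * (d - 1) / (n - 1)\<close>, at most a quarter of \<open>\<eta> * \<mu>\<close> by the hypothesis on \<open>n\<close>. At
  such a distance from the mean the Chernoff bound with the fixed base \<open>z = exp 1\<close> suffices.
\<close>

lemma prob_not_codegree:
  fixes p \<eta> \<mu> :: real
  assumes d: "d \<ge> 2" and p: "0 \<le> p" "p \<le> 1" and \<eta>: "0 < \<eta>" "4 * (real d - 1) \<le> \<eta> * (real n - 1)"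
    and \<mu>: "\<mu> = p * real ((n - 1) choose (d - 1))" and uv: "u \<in> {1..n}" "v \<in> {1..n}"
  shows "measure_pmf.prob (random_hypergraph d n p) {E. \<not> codegree E u v \<le> \<eta> * \<mu>} \<le> exp (- (\<eta> / 2) * \<mu>)"
proof (cases "u = v")
  case True
  have "0 \<le> \<eta> * \<mu>" using \<eta> p by (simp add: \<mu>)
  then have "{E. \<not> codegree E u v \<le> \<eta> * \<mu>} = {}" using True by (auto simp: codegree_def)
  then show ?thesis by (simp only: measure_empty) simp
next
  case False
  let ?H = "random_hypergraph d n p"
  let ?T = "{e\<in>all_hyperedges d n. u \<in> e \<and> v \<in> e}"
  have "2 \<le> n" using uv False by auto
  have "(real d - 1) * real ((n - 1) choose (d - 1)) = (real n - 1) * card ?T"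
  proof -
    have "(d - 1) * ((n - 1) choose (d - 1)) = (n - 1) * card ?T"
      using times_binomial_minus1_eq[of "d - 1" "n - 1"] d
      by (simp add: card_double_star[OF d uv False] numeral_2_eq_2)
    then have "real (d - 1) * real ((n - 1) choose (d - 1)) = real (n - 1) * real (card ?T)"
      by (simp only: flip: of_nat_mult)
    then show ?thesis using d \<open>2 \<le> n\<close> by (simp add: of_nat_diff)
  qed
  then have "(real n - 1) * (p * card ?T) = (real d - 1) * \<mu>" by (simp add: \<mu> mult_ac)
  moreover have "4 * (real d - 1) * \<mu> \<le> \<eta> * (real n - 1) * \<mu>"
    using \<eta> p by (intro mult_right_mono) (auto simp: \<mu>)
  ultimately have "(real n - 1) * (4 * (p * card ?T)) \<le> (real n - 1) * (\<eta> * \<mu>)"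
    by (simp only: mult.left_commute[of _ 4]) (simp add: mult_ac)
  then have small: "4 * (p * card ?T) \<le> \<eta> * \<mu>" using \<open>2 \<le> n\<close> by simp
  have "codegree E u v = card (E \<inter> ?T)" if "E \<in> set_pmf ?H" for E
    using set_random_hypergraph[OF that] False by (auto simp: codegree_def intro!: arg_cong[where f = card])
  then have "measure_pmf.prob ?H {E. \<not> codegree E u v \<le> \<eta> * \<mu>} \<le> measure_pmf.prob ?H {E. \<eta> * \<mu> \<le> card (E \<inter> ?T)}"
    by (intro measure_pmf.finite_measure_mono_AE) (auto simp: AE_measure_pmf_iff)
  also have "\<dots> \<le> exp (p * card ?T * (exp 1 - 1) - \<eta> * \<mu> * ln (exp 1))"
    using p by (intro chernoff_upper) auto
  also have "p * card ?T * (exp 1 - 1) \<le> p * card ?T * 2"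
    using p exp_le by (intro mult_left_mono) auto
  then have "exp (p * card ?T * (exp 1 - 1) - \<eta> * \<mu> * ln (exp 1)) \<le> exp (- (\<eta> / 2) * \<mu>)"
    using small by simp
  finally show ?thesis .
qed

text \<open>
  The bound is a power with exponent \<open>card S\<close>, so that it can be summed over all \<open>S\<close> with
  \<open>sum_power_card\<close>.
\<close>

lemma prob_not_crossing:
  fixes p \<mu> :: real
  assumes d: "d \<ge> 2" and p: "0 \<le> p" "p \<le> 1"
    and \<mu>: "\<mu> = p * real ((n - 1) choose (d - 1))" and S: "S \<subseteq> {1..n}" "2 * card S \<le> n"
  shows "measure_pmf.prob (random_hypergraph d n p) {E. \<not> \<mu> / (4 * real d) * card S \<le> card (crossing E S)}
    \<le> exp (- (rate (1 / 2) / (2 * real d)) * \<mu>) ^ card S"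
proof -
  let ?H = "random_hypergraph d n p"
  let ?T = "crossing (all_hyperedges d n) S"
  have "real (card S * ((n - 1) choose (d - 1))) \<le> real (2 * d * card ?T)"
    using card_crossing_ge[OF d S] by (simp only: of_nat_le_iff)
  from mult_left_mono[OF this p(1)] have "card S * \<mu> \<le> 2 * d * (p * card ?T)"
    by (simp add: \<mu> mult_ac)
  then have le: "\<mu> / (2 * real d) * card S \<le> p * card ?T" using d by (simp add: field_simps)
  have eq: "crossing E S = E \<inter> ?T" if "E \<in> set_pmf ?H" for E
    using set_random_hypergraph[OF that] by (auto simp: crossing_def)
  have "measure_pmf.prob ?H {E. \<not> \<mu> / (4 * real d) * card S \<le> card (crossing E S)} \<le>
      measure_pmf.prob ?H {E. card (E \<inter> ?T) \<le> 1 / 2 * (p * card ?T)}"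
    using le by (intro measure_pmf.finite_measure_mono_AE) (auto simp: AE_measure_pmf_iff eq)
  also have "\<dots> \<le> exp (p * card ?T * (1 / 2 - 1) - 1 / 2 * (p * card ?T) * ln (1 / 2))"
    using p by (intro chernoff_lower) (auto simp: crossing_def)
  also have "\<dots> = exp (- rate (1 / 2) * (p * card ?T))"
    by (simp add: rate_def algebra_simps)
  also have "\<dots> \<le> exp (- rate (1 / 2) * (\<mu> / (2 * real d) * card S))"
    using le rate_pos[of "1 / 2"] by (intro iffD2[OF exp_le_cancel_iff] mult_left_mono_neg) auto
  also have "\<dots> = exp (- (rate (1 / 2) / (2 * real d)) * \<mu>) ^ card S"
    by (simp add: exp_of_nat_mult[symmetric] mult_ac)
  finally show ?thesis .
qed

lemma prob_not_pseudorandom: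
  fixes p \<delta> \<eta> \<mu> :: real
  assumes d: "d \<ge> 2" and p: "0 \<le> p" "p \<le> 1" and \<delta>: "0 < \<delta>" "\<delta> < 1"
    and \<eta>: "0 < \<eta>" "4 * (real d - 1) \<le> \<eta> * (real n - 1)"
    and \<mu>: "\<mu> = p * real ((n - 1) choose (d - 1))"
  shows "measure_pmf.prob (random_hypergraph d n p) {E. \<not> pseudorandom d n \<mu> \<delta> \<eta> E} \<le>
    n * (exp (- rate (1 - \<delta>) * \<mu>) + exp (- rate (1 + \<delta>) * \<mu>)) + (real n)\<^sup>2 * exp (- (\<eta> / 2) * \<mu>) +
    ((1 + exp (- (rate (1 / 2) / (2 * real d)) * \<mu>)) ^ n - 1)"
proof -
  let ?P = "measure_pmf.prob (random_hypergraph d n p)"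
  let ?D = "\<lambda>v. {E. \<not> ((1 - \<delta>) * \<mu> \<le> real (vertex_degree E v) \<and> real (vertex_degree E v) \<le> (1 + \<delta>) * \<mu>)}"
  let ?C = "\<lambda>(u, v). {E. \<not> codegree E u v \<le> \<eta> * \<mu>}"
  let ?X = "\<lambda>S. {E. \<not> \<mu> / (4 * real d) * card S \<le> card (crossing E S)}"
  let ?F = "{S. S \<subseteq> {1..n} \<and> S \<noteq> {} \<and> 2 * card S \<le> n}"
  have F: "?F \<subseteq> Pow {1..n} - {{}}" by auto
  then have finF: "finite ?F" by (rule finite_subset) auto
  have "{E. \<not> pseudorandom d n \<mu> \<delta> \<eta> E} \<subseteq>
      (\<Union>v\<in>{1..n}. ?D v) \<union> (\<Union>uv\<in>{1..n} \<times> {1..n}. ?C uv) \<union> (\<Union>S\<in>?F. ?X S)"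
    unfolding pseudorandom_def by blast
  then have "?P {E. \<not> pseudorandom d n \<mu> \<delta> \<eta> E} \<le>
      ?P ((\<Union>v\<in>{1..n}. ?D v) \<union> (\<Union>uv\<in>{1..n} \<times> {1..n}. ?C uv) \<union> (\<Union>S\<in>?F. ?X S))"
    by (intro measure_pmf.finite_measure_mono) auto
  also have "\<dots> \<le> ?P (\<Union>v\<in>{1..n}. ?D v) + ?P (\<Union>uv\<in>{1..n} \<times> {1..n}. ?C uv) + ?P (\<Union>S\<in>?F. ?X S)"
    by (intro order_trans[OF measure_Un_le] add_mono) auto
  also have "?P (\<Union>v\<in>{1..n}. ?D v) \<le> n * (exp (- rate (1 - \<delta>) * \<mu>) + exp (- rate (1 + \<delta>) * \<mu>))"
  proof -
    have "?P (\<Union>v\<in>{1..n}. ?D v) \<le> (\<Sum>v\<in>{1..n}. ?P (?D v))" by (rule measure_UNION_le) auto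
    also have "\<dots> \<le> (\<Sum>v\<in>{1..n}. exp (- rate (1 - \<delta>) * \<mu>) + exp (- rate (1 + \<delta>) * \<mu>))"
      by (intro sum_mono prob_not_degree[OF d p \<delta> \<mu>])
    finally show ?thesis by simp
  qed
  also have "?P (\<Union>uv\<in>{1..n} \<times> {1..n}. ?C uv) \<le> (real n)\<^sup>2 * exp (- (\<eta> / 2) * \<mu>)"
  proof -
    have "?P (\<Union>uv\<in>{1..n} \<times> {1..n}. ?C uv) \<le> (\<Sum>uv\<in>{1..n} \<times> {1..n}. ?P (?C uv))"
      by (rule measure_UNION_le) auto
    also have "\<dots> \<le> (\<Sum>uv\<in>{1..n} \<times> {1..n}. exp (- (\<eta> / 2) * \<mu>))"
      using prob_not_codegree[OF d p \<eta> \<mu>] by (intro sum_mono) auto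
    finally show ?thesis by (simp add: power2_eq_square)
  qed
  also have "?P (\<Union>S\<in>?F. ?X S) \<le> (1 + exp (- (rate (1 / 2) / (2 * real d)) * \<mu>)) ^ n - 1"
  proof -
    let ?q = "exp (- (rate (1 / 2) / (2 * real d)) * \<mu>)"
    have "?P (\<Union>S\<in>?F. ?X S) \<le> (\<Sum>S\<in>?F. ?P (?X S))" by (rule measure_UNION_le[OF finF]) auto
    also have "\<dots> \<le> (\<Sum>S\<in>?F. ?q ^ card S)"
      using prob_not_crossing[OF d p \<mu>] by (intro sum_mono) auto
    also have "\<dots> \<le> (\<Sum>S\<in>Pow {1..n} - {{}}. ?q ^ card S)"
      using F by (intro sum_mono2) auto
    also have "\<dots> = (1 + ?q) ^ n - 1" by (subst sum_power_card) auto
    finally show ?thesis .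
  qed
  finally show ?thesis by simp
qed

section \<open>Commute times in pseudorandom hypergraphs\<close>

lemma crossing_complement:
  assumes "E \<subseteq> all_hyperedges d n" "S \<subseteq> {1..n}"
  shows "crossing E ({1..n} - S) = crossing E S"
proof -
  have "e \<subseteq> {1..n}" if "e \<in> E" for e using that assms(1) all_hyperedgesD(1)[of e d n] by blast
  then show ?thesis using assms(2) unfolding crossing_def by blast
qed

context
  fixes d n :: nat and \<mu> \<delta> \<eta> :: real and E :: "nat set set"
  assumes E: "E \<subseteq> all_hyperedges d n" and d: "d \<ge> 2" and \<mu>: "0 < \<mu>" and \<delta>: "0 \<le> \<delta>" "\<delta> < 1"
    and reg: "pseudorandom d n \<mu> \<delta> \<eta> E"
begin

text \<open>
  A set and its complement are crossed by the same hyperedges, and one of the two contains at most half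
  of the vertices.
\<close>

lemma pseudorandom_crossing_nonempty:
  assumes "S \<subseteq> {1..n}" "S \<noteq> {}" "S \<noteq> {1..n}"
  shows "crossing E S \<noteq> {}"
proof -
  have small: "crossing E S \<noteq> {}" if "S \<subseteq> {1..n}" "S \<noteq> {}" "2 * card S \<le> n" for S
  proof -
    have "0 < card S" using that finite_subset[of S "{1..n}"] by (auto simp: card_gt_0_iff)
    then have "0 < \<mu> / (4 * real d) * card S" using \<mu> d by simp
    also have "\<dots> \<le> card (crossing E S)" using reg that unfolding pseudorandom_def by blast
    finally show ?thesis by auto
  qed
  show ?thesis
  proof (cases "2 * card S \<le> n")
    case True
    with assms show ?thesis by (intro small)
  next
    case False
    have "card ({1..n} - S) = n - card S"
      using assms(1) finite_subset[of S "{1..n}"] by (simp add: card_Diff_subset)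
    then have "crossing E ({1..n} - S) \<noteq> {}" using False assms by (intro small) auto
    then show ?thesis unfolding crossing_complement[OF E assms(1)] .
  qed
qed

lemma pseudorandom_connected_hypergraph: "connected_hypergraph n E"
  by (rule connected_hypergraphI[OF pseudorandom_crossing_nonempty E])

lemma pseudorandom_weight:
  assumes v: "v \<in> {1..n}"
  shows "(1 - \<delta>) * ((real d - 1) * \<mu>) \<le> network.weight {1..n} (codegree E) v"
    and "network.weight {1..n} (codegree E) v \<le> (1 + \<delta>) * ((real d - 1) * \<mu>)"
proof -
  have "(1 - \<delta>) * \<mu> \<le> real (vertex_degree E v)" "real (vertex_degree E v) \<le> (1 + \<delta>) * \<mu>"
    using reg v unfolding pseudorandom_def by auto
  from this[THEN mult_left_mono, of "real d - 1"] d
  show "(1 - \<delta>) * ((real d - 1) * \<mu>) \<le> network.weight {1..n} (codegree E) v"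
    and "network.weight {1..n} (codegree E) v \<le> (1 + \<delta>) * ((real d - 1) * \<mu>)"
    unfolding weight_codegree[OF E v] by (simp_all add: mult_ac)
qed

lemma pseudorandom_connected_network: "connected_network {1..n} (codegree E)"
proof -
  interpret network "{1..n}" "codegree E" by (rule network_codegree)
  show ?thesis
  proof
    fix v assume "v \<in> {1..n}"
    then show "0 < weight v"
      using \<mu> \<delta> d by (intro less_le_trans[OF _ pseudorandom_weight(1)]) auto
  next
    fix S assume S: "S \<subseteq> {1..n}" "S \<noteq> {}" "S \<noteq> {1..n}"
    then have "crossing E S \<noteq> {}" by (rule pseudorandom_crossing_nonempty)
    moreover have "finite (crossing E S)"
      using finite_subset[OF E finite_all_hyperedges] by (simp add: crossing_def)
    ultimately have "0 < cut S"
      by (intro less_le_trans[OF _ crossing_le_cut[OF E S(1)]]) (simp add: card_gt_0_iff)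
    show "\<exists>u\<in>S. \<exists>v\<in>{1..n} - S. 0 < codegree E u v"
    proof (rule ccontr)
      assume "\<not> (\<exists>u\<in>S. \<exists>v\<in>{1..n} - S. 0 < codegree E u v)"
      then have "cut S \<le> 0" unfolding cut_def by (intro sum_nonpos) (meson not_less)
      with \<open>0 < cut S\<close> show False by simp
    qed
  qed
qed

text \<open>
  The expansion constant \<open>\<beta>\<close> depends on \<open>d\<close> only, whereas \<open>\<delta>\<close>, \<open>\<theta>\<close> and \<open>\<eta> / \<theta>\<close> can be made small, so the
  bounds on \<open>\<kappa>\<close> approach \<open>n\<close> and \<open>2 * n\<close>.
\<close>

lemma commute_time_pseudorandom:
  fixes \<theta> :: real
  defines "\<beta> \<equiv> 1 / (4 * real d * (real d - 1))"
  assumes \<theta>: "0 < \<theta>" "\<theta> \<le> 1" and \<eta>: "0 \<le> \<eta>" and ij: "i \<in> {1..n}" "j \<in> {1..n}" "i \<noteq> j"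
  obtains \<kappa> where "commute_time n E i j = ennreal \<kappa>" "(1 - \<delta>) / (1 + \<delta>) * n \<le> \<kappa>"
    "((1 - \<theta>) * (1 - \<delta>) / 2 - \<eta>) * \<kappa> \<le> (1 + \<delta>) * (1 + 8 * \<eta> / (\<theta> * \<beta>\<^sup>2)) * n"
proof -
  note conn = pseudorandom_connected_network
  interpret connected_network "{1..n}" "codegree E" by (rule conn)
  let ?m = "(real d - 1) * \<mu>"
  have \<beta>: "0 < \<beta>" "\<beta> * ?m = \<mu> / (4 * real d)" using d by (simp_all add: \<beta>_def)
  have m: "0 < ?m" using d \<mu> by simp
  have iso: "\<beta> * ?m * card S \<le> cut S" if S: "S \<subseteq> {1..n}" "S \<noteq> {}" "2 * card S \<le> card {1..n}" for S
    unfolding \<beta>(2) using reg S by (intro order_trans[OF _ crossing_le_cut[OF E S(1)]]) (simp add: pseudorandom_def)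
  have small: "codegree E u v \<le> \<eta> * ?m" if "u \<in> {1..n}" "v \<in> {1..n}" for u v
  proof -
    have "codegree E u v \<le> \<eta> * \<mu>" using reg that by (simp add: pseudorandom_def)
    also have "\<eta> * \<mu> \<le> \<eta> * ?m" using \<eta> d \<mu> by (intro mult_left_mono) (auto simp: mult_le_cancel_right1)
    finally show ?thesis .
  qed
  note bounds = commute_bounds[OF iso \<beta>(1) m \<theta> \<delta> \<eta> pseudorandom_weight small ij
      mean_hitting_target laplacian_mean_hitting[OF ij(2)] mean_hitting_target laplacian_mean_hitting[OF ij(1)]]
  show ?thesis
  proof (rule that)
    show "commute_time n E i j = ennreal (mean_hitting j i + mean_hitting i j)"
      unfolding commute_time_def expected_hitting_time_eq[OF E d conn ij(1,2)] expected_hitting_time_eq[OF E d conn ij(2,1)]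
      using mean_hitting_nonneg ij by (intro ennreal_plus[symmetric]) auto
  qed (use bounds in simp_all)
qed

end

section \<open>Asymptotics\<close>

text \<open>
  The expected degree is of order \<open>n ^ (d - 1) * p n\<close>, up to a constant that depends on \<open>d\<close>, and thus
  eventually exceeds every multiple of \<open>ln n\<close>. The power \<open>3\<close> leaves room for a union bound over
  pairs of vertices.
\<close>

lemma expected_degree_superlogarithmic:
  fixes p :: "nat \<Rightarrow> real"
  assumes d: "d \<ge> 2" and p: "\<And>n. n \<ge> 1 \<Longrightarrow> 0 < p n \<and> p n < 1"
    and lim: "(\<lambda>n. (ln (real n) ^ 4 / real n ^ (d - 1)) / (p n * (1 - p n))) \<longlonglongrightarrow> 0" and c: "0 < c"
  shows "\<forall>\<^sub>F n in sequentially. exp (- c * (p n * real ((n - 1) choose (d - 1)))) \<le> 1 / real n ^ 3"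
proof -
  define K where "K = (2 * real (d - 1)) ^ (d - 1)"
  have K: "0 < K" using d by (simp add: K_def)
  have "\<forall>\<^sub>F n in sequentially. (ln (real n) ^ 4 / real n ^ (d - 1)) / (p n * (1 - p n)) < c / (3 * K)"
    using c K by (intro order_tendstoD(2)[OF lim]) auto
  moreover have "\<forall>\<^sub>F n in sequentially. n \<ge> d + 3" by (rule eventually_ge_at_top)
  ultimately show ?thesis
  proof eventually_elim
    case (elim n)
    let ?l = "ln (real n)" and ?b = "real ((n - 1) choose (d - 1))"
    have pn: "0 < p n" "p n < 1" using p[of n] elim by auto
    have "exp 1 \<le> real n" using exp_le elim by linarith
    then have l: "1 \<le> ?l" using elim by (subst ln_ge_iff) auto
    \<comment> \<open>the factor \<open>2\<close> in \<open>K\<close> pays for replacing \<open>n - 1\<close> by \<open>n\<close>\<close>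
    have "(real n / (2 * real (d - 1))) ^ (d - 1) \<le> (real (n - 1) / real (d - 1)) ^ (d - 1)"
    proof (rule power_mono)
      have "real n / 2 \<le> real (n - 1)" using elim(2) by simp
      from divide_right_mono[OF this, of "real (d - 1)"]
      show "real n / (2 * real (d - 1)) \<le> real (n - 1) / real (d - 1)" by simp
    qed simp
    also have "\<dots> \<le> ?b" using elim by (intro binomial_ge_n_over_k_pow_k) auto
    finally have b: "real n ^ (d - 1) / K \<le> ?b" by (simp add: K_def power_divide)
    have "?l ^ 4 / real n ^ (d - 1) < c / (3 * K) * (p n * (1 - p n))"
      using elim(1) pn by (subst (asm) pos_divide_less_eq) auto
    also have "\<dots> \<le> c / (3 * K) * p n" using pn c K by (intro mult_left_mono) (auto simp: mult_le_cancel_left1)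
    finally have "?l ^ 4 < c / (3 * K) * p n * real n ^ (d - 1)" using elim by (simp add: pos_divide_less_eq)
    also have "\<dots> = c / 3 * p n * (real n ^ (d - 1) / K)" by simp
    also have "\<dots> \<le> c / 3 * p n * ?b" using b c pn by (intro mult_left_mono) auto
    finally have "3 * ?l ^ 4 \<le> c * (p n * ?b)" by simp
    moreover have "?l \<le> ?l ^ 4" using power_increasing[of 1 4 ?l] l by simp
    ultimately have "- c * (p n * ?b) \<le> - (3 * ?l)" by simp
    then have "exp (- c * (p n * ?b)) \<le> exp (- (real 3 * ?l))" by simp
    also have "\<dots> = 1 / real n ^ 3"
      using elim by (subst exp_minus, subst exp_of_nat_mult) (simp add: inverse_eq_divide)
    finally show ?case .
  qed
qed

lemma pseudorandom_asymptotically_almost_surely: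
  fixes p :: "nat \<Rightarrow> real" and d :: nat
  defines "\<mu> \<equiv> \<lambda>n. p n * real ((n - 1) choose (d - 1))"
  assumes d: "d \<ge> 2" and p: "\<And>n. n \<ge> 1 \<Longrightarrow> 0 < p n \<and> p n < 1"
    and lim: "(\<lambda>n. (ln (real n) ^ 4 / real n ^ (d - 1)) / (p n * (1 - p n))) \<longlonglongrightarrow> 0"
    and \<delta>: "0 < \<delta>" "\<delta> < 1" and \<eta>: "0 < \<eta>"
  shows "(\<lambda>n. measure_pmf.prob (random_hypergraph d n (p n)) {E. pseudorandom d n (\<mu> n) \<delta> \<eta> E}) \<longlonglongrightarrow> 1"
proof -
  let ?P = "\<lambda>n. measure_pmf.prob (random_hypergraph d n (p n))"
  \<comment> \<open>the value of the bound of \<open>prob_not_pseudorandom\<close> with all exponentials replaced by \<open>n\<close> to the power \<open>-3\<close>,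
    up to \<open>1 + x \<le> exp x\<close> in the last term\<close>
  define err :: "nat \<Rightarrow> real" where "err n = 2 / (real n)\<^sup>2 + 1 / real n + (exp (1 / (real n)\<^sup>2) - 1)" for n
  have "err \<longlonglongrightarrow> 2 * 0 + 0 + (exp 0 - 1)"
  proof -
    have 1: "(\<lambda>n. 1 / real n) \<longlonglongrightarrow> 0" by (rule lim_1_over_n)
    have 2: "(\<lambda>n. 1 / (real n)\<^sup>2) \<longlonglongrightarrow> 0" using tendsto_power[OF 1, of 2] by (simp add: power_divide)
    have "err = (\<lambda>n. 2 * (1 / (real n)\<^sup>2) + 1 / real n + (exp (1 / (real n)\<^sup>2) - 1))"
      by (simp add: err_def fun_eq_iff)
    then show ?thesis by (simp only:) (intro tendsto_intros 1 2)
  qed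
  then have "(\<lambda>n. 1 - err n) \<longlonglongrightarrow> 1" using tendsto_diff[OF tendsto_const[of 1]] by fastforce
  moreover have "\<forall>\<^sub>F n in sequentially. 1 - err n \<le> ?P n {E. pseudorandom d n (\<mu> n) \<delta> \<eta> E}"
  proof -
    have tail: "\<forall>\<^sub>F n in sequentially. exp (- c * \<mu> n) \<le> 1 / real n ^ 3" if "0 < c" for c
      unfolding \<mu>_def using d p lim that by (rule expected_degree_superlogarithmic)
    have r: "0 < rate (1 - \<delta>)" "0 < rate (1 + \<delta>)" "0 < \<eta> / 2" "0 < rate (1 / 2) / (2 * real d)"
      using rate_pos[of "1 - \<delta>"] rate_pos[of "1 + \<delta>"] rate_pos[of "1 / 2"] \<delta> \<eta> d by auto
    have "\<forall>\<^sub>F n in sequentially. nat \<lceil>4 * (real d - 1) / \<eta>\<rceil> + 1 \<le> n" by (rule eventually_ge_at_top)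
    with tail[OF r(1)] tail[OF r(2)] tail[OF r(3)] tail[OF r(4)] show ?thesis
    proof eventually_elim
      case (elim n)
      have n: "1 \<le> n" using elim by simp
      have "4 * (real d - 1) / \<eta> \<le> real n - 1" using elim(5) by linarith
      then have \<eta>': "4 * (real d - 1) \<le> \<eta> * (real n - 1)" using \<eta> by (simp add: pos_divide_le_eq mult.commute)
      have "?P n {E. \<not> pseudorandom d n (\<mu> n) \<delta> \<eta> E} \<le>
          n * (exp (- rate (1 - \<delta>) * \<mu> n) + exp (- rate (1 + \<delta>) * \<mu> n)) + (real n)\<^sup>2 * exp (- (\<eta> / 2) * \<mu> n) +
          ((1 + exp (- (rate (1 / 2) / (2 * real d)) * \<mu> n)) ^ n - 1)"
        using p[OF n] by (intro prob_not_pseudorandom[OF d _ _ \<delta> \<eta> \<eta>']) (auto simp: \<mu>_def)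
      also have "\<dots> \<le> n * (1 / real n ^ 3 + 1 / real n ^ 3) + (real n)\<^sup>2 * (1 / real n ^ 3) + ((1 + 1 / real n ^ 3) ^ n - 1)"
        by (intro add_mono diff_mono power_mono mult_left_mono elim(1-4)) auto
      also have "(1 + 1 / real n ^ 3) ^ n \<le> exp (1 / real n ^ 3) ^ n"
        by (intro power_mono) auto
      also have "exp (1 / real n ^ 3) ^ n = exp (1 / (real n)\<^sup>2)"
        using n by (simp add: exp_of_nat_mult[symmetric] power2_eq_square power3_eq_cube)
      also have "n * (1 / real n ^ 3 + 1 / real n ^ 3) + (real n)\<^sup>2 * (1 / real n ^ 3) + (exp (1 / (real n)\<^sup>2) - 1) = err n"
        using n by (simp add: err_def power2_eq_square power3_eq_cube field_simps)
      finally have "?P n {E. \<not> pseudorandom d n (\<mu> n) \<delta> \<eta> E} \<le> err n" by simp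
      moreover have "?P n {E. \<not> pseudorandom d n (\<mu> n) \<delta> \<eta> E} = 1 - ?P n {E. pseudorandom d n (\<mu> n) \<delta> \<eta> E}"
        by (subst measure_pmf.prob_compl[symmetric]) (auto intro!: arg_cong[where f = "?P n"])
      ultimately show ?case by simp
    qed
  qed
  ultimately show ?thesis
    by (rule tendsto_sandwich[OF _ _ _ tendsto_const, rotated 2]) auto
qed

text \<open>
  The conditional probability is the probability of the intersection divided by a number
  in \<open>{0..1}\<close>.
\<close>

lemma cond_prob_ge:
  fixes M :: "'a pmf"
  assumes "AE x in measure_pmf M. R x \<longrightarrow> P x \<and> Q x"
  shows "measure_pmf.prob M {x. R x} \<le> \<P>(x in measure_pmf M. P x \<bar> Q x)"
proof -
  let ?PQ = "measure_pmf.prob M {x. P x \<and> Q x}" and ?Q = "measure_pmf.prob M {x. Q x}"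
  have "measure_pmf.prob M {x. R x} \<le> ?PQ"
    using assms by (intro measure_pmf.finite_measure_mono_AE) auto
  also have "?PQ \<le> ?PQ / ?Q"
  proof (cases "?Q = 0")
    case True
    moreover have "?PQ \<le> ?Q" by (intro measure_pmf.finite_measure_mono) auto
    ultimately show ?thesis by simp
  next
    case False
    then have "0 < ?Q" by (simp add: zero_less_measure_iff)
    then show ?thesis by (simp add: le_divide_eq mult_left_le)
  qed
  finally show ?thesis by (simp add: cond_prob_def)
qed

lemma cond_prob_le_1:
  fixes M :: "'a pmf"
  shows "\<P>(x in measure_pmf M. P x \<bar> Q x) \<le> 1"
proof -
  have "measure_pmf.prob M {x. P x \<and> Q x} \<le> measure_pmf.prob M {x. Q x}"
    by (intro measure_pmf.finite_measure_mono) auto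
  then show ?thesis by (simp add: cond_prob_def divide_le_eq_1 zero_less_measure_iff)
qed

text \<open>
  The two quotients are the factors of \<open>n\<close> in \<open>commute_time_pseudorandom\<close> for \<open>\<delta> = \<theta>\<close> and \<open>\<eta> = \<theta>\<^sup>2\<close>; as \<open>\<theta>\<close>
  tends to \<open>0\<close>, they tend to \<open>1\<close> and \<open>2\<close>. The constant \<open>B\<close> stands for \<open>8 / \<beta>\<^sup>2\<close>.
\<close>

lemma ex_tolerance:
  fixes \<epsilon> B :: real
  assumes "0 < \<epsilon>"
  obtains \<theta> where "0 < \<theta>" "\<theta> < 1" "1 - \<epsilon> \<le> (1 - \<theta>) / (1 + \<theta>)" "0 < (1 - \<theta>) * (1 - \<theta>) / 2 - \<theta>\<^sup>2"
    "(1 + \<theta>) * (1 + B * \<theta>) / ((1 - \<theta>) * (1 - \<theta>) / 2 - \<theta>\<^sup>2) \<le> 2 * (1 + \<epsilon>)"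
proof -
  have "((\<lambda>\<theta>. (1 - \<theta>) / (1 + \<theta>)) \<longlongrightarrow> (1 - 0) / (1 + 0)) (at_right (0::real))"
    by (intro tendsto_intros) auto
  then have 1: "\<forall>\<^sub>F \<theta> in at_right 0. 1 - \<epsilon> < (1 - \<theta>) / (1 + \<theta>)"
    using assms by (intro order_tendstoD(1)) auto
  have "((\<lambda>\<theta>. (1 - \<theta>) * (1 - \<theta>) / 2 - \<theta>\<^sup>2) \<longlongrightarrow> (1 - 0) * (1 - 0) / 2 - 0\<^sup>2) (at_right (0::real))"
    by (intro tendsto_intros) auto
  then have 2: "\<forall>\<^sub>F \<theta> in at_right (0::real). 0 < (1 - \<theta>) * (1 - \<theta>) / 2 - \<theta>\<^sup>2"
    by (intro order_tendstoD(1)) auto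
  have "((\<lambda>\<theta>. (1 + \<theta>) * (1 + B * \<theta>) / ((1 - \<theta>) * (1 - \<theta>) / 2 - \<theta>\<^sup>2)) \<longlongrightarrow>
      (1 + 0) * (1 + B * 0) / ((1 - 0) * (1 - 0) / 2 - 0\<^sup>2)) (at_right (0::real))"
    by (intro tendsto_intros) auto
  then have 3: "\<forall>\<^sub>F \<theta> in at_right 0. (1 + \<theta>) * (1 + B * \<theta>) / ((1 - \<theta>) * (1 - \<theta>) / 2 - \<theta>\<^sup>2) < 2 * (1 + \<epsilon>)"
    using assms by (intro order_tendstoD(2)) auto
  have 4: "\<forall>\<^sub>F \<theta> in at_right 0. (0::real) < \<theta> \<and> \<theta> < 1"
    by (auto simp: eventually_at_right_field intro!: exI[of _ 1])
  from eventually_happens[OF eventually_conj[OF eventually_conj[OF 1 2] eventually_conj[OF 3 4]]]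
  obtain \<theta> :: real where "(1 - \<epsilon> < (1 - \<theta>) / (1 + \<theta>) \<and> 0 < (1 - \<theta>) * (1 - \<theta>) / 2 - \<theta>\<^sup>2) \<and>
      (1 + \<theta>) * (1 + B * \<theta>) / ((1 - \<theta>) * (1 - \<theta>) / 2 - \<theta>\<^sup>2) < 2 * (1 + \<epsilon>) \<and> 0 < \<theta> \<and> \<theta> < 1"
    by auto
  then show ?thesis by (intro that[of \<theta>]) auto
qed

theorem theorem5:
  fixes d :: nat and p :: "nat \<Rightarrow> real" and i j :: "nat \<Rightarrow> nat" and \<epsilon> :: real
  assumes "d \<ge> 2"
    and "\<And>n. n \<ge> 1 \<Longrightarrow> 0 < p n \<and> p n < 1"
    and "(\<lambda>n. (ln (real n) ^ 4 / real n ^ (d - 1)) / (p n * (1 - p n))) \<longlonglongrightarrow> 0"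
    and "\<And>n. n \<ge> 2 \<Longrightarrow> i n \<in> {1..n} \<and> j n \<in> {1..n} \<and> i n \<noteq> j n"
    and "\<epsilon> > 0"
  shows "(\<lambda>n. \<P>(E in random_hypergraph d n (p n).
            ennreal ((1 - \<epsilon>) * real n) \<le> commute_time n E (i n) (j n) \<and>
            commute_time n E (i n) (j n) \<le> ennreal (2 * (1 + \<epsilon>) * real n)
            \<bar> connected_hypergraph n E)) \<longlonglongrightarrow> 1"
proof -
  define \<beta> where "\<beta> = 1 / (4 * real d * (real d - 1))"
  define \<mu> where "\<mu> n = p n * real ((n - 1) choose (d - 1))" for n
  let ?good = "\<lambda>n E. ennreal ((1 - \<epsilon>) * real n) \<le> commute_time n E (i n) (j n) \<and>
            commute_time n E (i n) (j n) \<le> ennreal (2 * (1 + \<epsilon>) * real n)"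
  obtain \<theta> where \<theta>: "0 < \<theta>" "\<theta> < 1" "1 - \<epsilon> \<le> (1 - \<theta>) / (1 + \<theta>)" "0 < (1 - \<theta>) * (1 - \<theta>) / 2 - \<theta>\<^sup>2"
    "(1 + \<theta>) * (1 + 8 / \<beta>\<^sup>2 * \<theta>) / ((1 - \<theta>) * (1 - \<theta>) / 2 - \<theta>\<^sup>2) \<le> 2 * (1 + \<epsilon>)"
    by (rule ex_tolerance[OF assms(5)])
  let ?A = "(1 - \<theta>) * (1 - \<theta>) / 2 - \<theta>\<^sup>2"
  have good: "?good n E \<and> connected_hypergraph n E"
    if n: "n \<ge> d + 2" and E: "E \<in> set_pmf (random_hypergraph d n (p n))" and reg: "pseudorandom d n (\<mu> n) \<theta> (\<theta>\<^sup>2) E" for n E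
  proof -
    note E' = set_random_hypergraph[OF E]
    have \<mu>: "0 < \<mu> n" using n assms(2)[of n] by (simp add: \<mu>_def)
    have ij: "i n \<in> {1..n}" "j n \<in> {1..n}" "i n \<noteq> j n" using assms(4)[of n] n by auto
    obtain \<kappa> where \<kappa>: "commute_time n E (i n) (j n) = ennreal \<kappa>" "(1 - \<theta>) / (1 + \<theta>) * n \<le> \<kappa>"
      "?A * \<kappa> \<le> (1 + \<theta>) * (1 + 8 * \<theta>\<^sup>2 / (\<theta> * \<beta>\<^sup>2)) * n"
      using commute_time_pseudorandom[OF E' assms(1) \<mu> less_imp_le[OF \<theta>(1)] \<theta>(2) reg \<theta>(1) less_imp_le[OF \<theta>(2)] zero_le_power2 ij]
      unfolding \<beta>_def by metis
    have "(1 - \<epsilon>) * real n \<le> (1 - \<theta>) / (1 + \<theta>) * n" by (intro mult_right_mono \<theta>(3)) auto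
    with \<kappa>(2) have lower: "(1 - \<epsilon>) * real n \<le> \<kappa>" by linarith
    have "8 * \<theta>\<^sup>2 / (\<theta> * \<beta>\<^sup>2) = 8 / \<beta>\<^sup>2 * \<theta>" using \<theta>(1) by (simp add: power2_eq_square)
    with \<kappa>(3) have "\<kappa> \<le> (1 + \<theta>) * (1 + 8 / \<beta>\<^sup>2 * \<theta>) * n / ?A"
      using \<theta>(4) by (simp only: pos_le_divide_eq mult.commute[of \<kappa>])
    also have "\<dots> = (1 + \<theta>) * (1 + 8 / \<beta>\<^sup>2 * \<theta>) / ?A * n" by (simp only: times_divide_eq_left)
    also have "\<dots> \<le> 2 * (1 + \<epsilon>) * n" by (intro mult_right_mono \<theta>(5)) auto
    finally have upper: "\<kappa> \<le> 2 * (1 + \<epsilon>) * n" .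
    have "connected_hypergraph n E"
      by (rule pseudorandom_connected_hypergraph[OF E' assms(1) \<mu> less_imp_le[OF \<theta>(1)] \<theta>(2) reg])
    with lower upper show ?thesis by (simp add: \<kappa>(1) ennreal_leI)
  qed
  show ?thesis
  proof (rule tendsto_sandwich[OF _ _ _ tendsto_const])
    show "(\<lambda>n. measure_pmf.prob (random_hypergraph d n (p n)) {E. pseudorandom d n (\<mu> n) \<theta> (\<theta>\<^sup>2) E}) \<longlonglongrightarrow> 1"
      using \<theta> unfolding \<mu>_def by (intro pseudorandom_asymptotically_almost_surely assms) auto
    show "\<forall>\<^sub>F n in sequentially. measure_pmf.prob (random_hypergraph d n (p n)) {E. pseudorandom d n (\<mu> n) \<theta> (\<theta>\<^sup>2) E}
        \<le> \<P>(E in random_hypergraph d n (p n). ?good n E \<bar> connected_hypergraph n E)"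
      using eventually_ge_at_top[of "d + 2"]
    proof eventually_elim
      case (elim n)
      then show ?case using good by (intro cond_prob_ge) (simp add: AE_measure_pmf_iff)
    qed
  qed (simp add: cond_prob_le_1)
qed

end
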